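(* Let $\Omega\subset M$ be an open set, $1<p<\infty$ and $\lambda\in\mathbb{R}$. Let $v$ be a positive sub-solution in $\Omega$ of the Dirichlet problem $$\mathcal{L}_p u=\lambda|u|^{p-2}u \ \text{ in }\Omega,\qquad u=0\ \text{ on }\partial\Omega.$$ Then for every fixed $q>p-1$ we have $$\int_{\Omega}v^{q-p}\phi^p|\nabla_X v|^p\,dx\le\left(\frac{p}{q-p+1}\right)^p\int_\Omega v^q|\nabla_X\phi|^p\,dx+\frac{\lambda p}{q-p+1}\int_\Omega v^q\phi^p\,dx$$ for all nonnegative functions $\phi\in C_0^\infty(\Omega)$.
   Context: $M$ is a smooth manifold of dimension $n$ with a volume form $dx$, and $\{X_k\}_{k=1}^N$, $N\le n$, is a family of vector fields on $M$, $X_k=\sum_{j=1}^n a_{kj}(x)\frac{\partial}{\partial x_j}$, with formal adjoints $X_k^*$. Write $\nabla_X=(X_1,\dots,X_N)$, $\nabla_X^*=(X_1^*,\dots,X_N^* )$, let $\langle\cdot,\cdot\rangle$ be the Euclidean inner product on $\mathbb{R}^N$, and $|\nabla_X u|=\left(\sum_{k=1}^N (X_ku)^2\right)^{1/2}$. The $p$-sub-Laplacian is $\mathcal{L}_p f=\nabla_X^*\cdot(|\nabla_X f|^{p-2}\nabla_X f)$. $\mathring{S}^{1,p}(\Omega)$ is the completion of $C_0^1(\Omega)$ in the norm generated by $J_p(u)=\left(\int_\Omega|\nabla_X u|^p dx\right)^{1/p}$; functions are real-valued. A sub-solution of the Dirichlet problem (with parameter $\lambda$) is a function $u\in\mathring{S}^{1,p}(\Omega)$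 such that $$\int_\Omega|\nabla_X u|^{p-2}\langle\nabla_X u,\nabla_X\phi\rangle dx-\lambda\int_\Omega|u|^{p-2}u\phi\,dx\le 0$$ for all nonnegative $\phi\in\mathring{S}^{1,p}(\Omega)$. *)

theory Defs
  imports "HOL-Analysis.Analysis"
begin

section \<open>Smooth manifolds, volume forms and vector fields in charts\<close>

text \<open>Intended for open \<open>S\<close> only.\<close>

primrec Ck_on :: "nat \<Rightarrow> 'a::euclidean_space set \<Rightarrow> ('a \<Rightarrow> 'b::real_normed_vector) \<Rightarrow> bool" where
  "Ck_on 0 S f \<longleftrightarrow> continuous_on S f"
| "Ck_on (Suc k) S f \<longleftrightarrow>
     f differentiable_on S \<and> (\<forall>e. Ck_on k S (\<lambda>x. frechet_derivative f (at x) e))"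

definition smooth_on :: "'a::euclidean_space set \<Rightarrow> ('a \<Rightarrow> 'b::real_normed_vector) \<Rightarrow> bool" where
  "smooth_on S f \<longleftrightarrow> (\<forall>k. Ck_on k S f)"

text \<open>
  The manifold is a whole type \<open>'m\<close>, Hausdorff and second countable by its type classes;
  a chart is its domain together with the coordinate map, and only the values of the latter on the
  domain matter. The dimension is \<open>CARD('n)\<close>.
\<close>

type_synonym ('m, 'n) chart = "'m set \<times> ('m \<Rightarrow> real ^ 'n)"

definition chart_image :: "('m, 'n) chart \<Rightarrow> (real ^ 'n) set" where
  "chart_image c = snd c ` fst c"

definition local_rep :: "('m, 'n) chart \<Rightarrow> ('m \<Rightarrow> 'b) \<Rightarrow> real ^ 'n \<Rightarrow> 'b" where
  "local_rep c u = u \<circ> inv_into (fst c) (snd c)"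

definition overlap :: "('m, 'n) chart \<Rightarrow> ('m, 'n) chart \<Rightarrow> (real ^ 'n) set" where
  "overlap c d = snd c ` (fst c \<inter> fst d)"

definition coord_change :: "('m, 'n) chart \<Rightarrow> ('m, 'n) chart \<Rightarrow> real ^ 'n \<Rightarrow> real ^ 'n" where
  "coord_change c d = local_rep c (snd d)"

definition smooth_atlas ::
  "('m::{t2_space, second_countable_topology}, 'n::finite) chart set \<Rightarrow> bool" where
  "smooth_atlas A \<longleftrightarrow>
     (\<Union>c\<in>A. fst c) = UNIV \<and>
     (\<forall>c\<in>A. open (fst c) \<and> open (chart_image c) \<and>
        homeomorphism (fst c) (chart_image c) (snd c) (inv_into (fst c) (snd c))) \<and>
     (\<forall>c\<in>A. \<forall>d\<in>A. smooth_on (overlap c d) (coord_change c d))"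

text \<open>
  A volume form is given by its coefficients: it is
  \<open>w c dx\<^sub>1 \<and> \<dots> \<and> dx\<^sub>n\<close> in the chart \<open>c\<close>, and nowhere zero.
\<close>

definition volume_form ::
  "('m::{t2_space, second_countable_topology}, 'n::finite) chart set
     \<Rightarrow> (('m, 'n) chart \<Rightarrow> real ^ 'n \<Rightarrow> real) \<Rightarrow> bool" where
  "volume_form A w \<longleftrightarrow>
     (\<forall>c\<in>A. smooth_on (chart_image c) (w c) \<and> (\<forall>y\<in>chart_image c. w c y \<noteq> 0)) \<and>
     (\<forall>c\<in>A. \<forall>d\<in>A. \<forall>y\<in>overlap c d.
        w c y = w d (coord_change c d y) *
          det (matrix (frechet_derivative (coord_change c d) (at y))))"

text \<open>
  Integration against the volume form, for the orientation it defines, is integration against the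
  Borel measure below, which the condition determines uniquely.
\<close>

definition volume_measure ::
  "('m::{t2_space, second_countable_topology}, 'n::finite) chart set
     \<Rightarrow> (('m, 'n) chart \<Rightarrow> real ^ 'n \<Rightarrow> real) \<Rightarrow> 'm measure \<Rightarrow> bool" where
  "volume_measure A w \<mu> \<longleftrightarrow>
     sets \<mu> = sets borel \<and>
     (\<forall>c\<in>A. \<forall>B\<in>sets borel. B \<subseteq> fst c \<longrightarrow>
        emeasure \<mu> B = (\<integral>\<^sup>+ y\<in>snd c ` B. ennreal \<bar>w c y\<bar> \<partial>lborel))"

text \<open>
  A vector field is \<open>\<Sum>\<^sub>j (a c)\<^sub>j \<partial>/\<partial>x\<^sub>j\<close> in the chart \<open>c\<close>.
\<close>

definition smooth_vector_field ::
  "('m::{t2_space, second_countable_topology}, 'n::finite) chart set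
     \<Rightarrow> (('m, 'n) chart \<Rightarrow> real ^ 'n \<Rightarrow> real ^ 'n) \<Rightarrow> bool" where
  "smooth_vector_field A a \<longleftrightarrow>
     (\<forall>c\<in>A. smooth_on (chart_image c) (a c)) \<and>
     (\<forall>c\<in>A. \<forall>d\<in>A. \<forall>y\<in>overlap c d.
        a d (coord_change c d y) = frechet_derivative (coord_change c d) (at y) (a c y))"

text \<open>
  For \<open>u\<close> differentiable at \<open>x\<close> the value does not depend on the chart that \<open>SOME\<close> picks.
\<close>

definition vf_apply ::
  "('m, 'n::finite) chart set \<Rightarrow> (('m, 'n) chart \<Rightarrow> real ^ 'n \<Rightarrow> real ^ 'n)
     \<Rightarrow> ('m \<Rightarrow> real) \<Rightarrow> 'm \<Rightarrow> real" where
  "vf_apply A a u x =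
     (let c = (SOME c. c \<in> A \<and> x \<in> fst c)
      in frechet_derivative (local_rep c u) (at (snd c x)) (a c (snd c x)))"

definition X_grad ::
  "('m, 'n::finite) chart set \<Rightarrow> ('k::finite \<Rightarrow> ('m, 'n) chart \<Rightarrow> real ^ 'n \<Rightarrow> real ^ 'n)
     \<Rightarrow> ('m \<Rightarrow> real) \<Rightarrow> 'm \<Rightarrow> real ^ 'k" where
  "X_grad A X u x = (\<chi> k. vf_apply A (X k) u x)"

section \<open>Function spaces\<close>

text \<open>Functions with compact support in \<open>\<Omega>\<close> are taken to be extended by zero.\<close>

definition C0k ::
  "('m::{t2_space, second_countable_topology}, 'n::finite) chart set \<Rightarrow> nat \<Rightarrow> 'm set
     \<Rightarrow> ('m \<Rightarrow> real) set" where
  "C0k A k \<Omega> = {u. (\<forall>c\<in>A. Ck_on k (chart_image c) (local_rep c u)) \<and>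
     compact (closure {x. u x \<noteq> 0}) \<and> closure {x. u x \<noteq> 0} \<subseteq> \<Omega>}"

definition C0_infty ::
  "('m::{t2_space, second_countable_topology}, 'n::finite) chart set \<Rightarrow> 'm set
     \<Rightarrow> ('m \<Rightarrow> real) set" where
  "C0_infty A \<Omega> = (\<Inter>k. C0k A k \<Omega>)"

definition J_norm ::
  "('m, 'n::finite) chart set \<Rightarrow> 'm measure
     \<Rightarrow> ('k::finite \<Rightarrow> ('m, 'n) chart \<Rightarrow> real ^ 'n \<Rightarrow> real ^ 'n) \<Rightarrow> 'm set \<Rightarrow> real
     \<Rightarrow> ('m \<Rightarrow> real) \<Rightarrow> real" where
  "J_norm A \<mu> X \<Omega> p u = (LINT x:\<Omega>|\<mu>. norm (X_grad A X u x) powr p) powr (1 / p)"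

text \<open>
  The completion of \<open>C\<^sub>0\<^sup>1(\<Omega>)\<close> for the norm \<open>J_norm\<close> is realised by real-valued functions:
  \<open>u\<close> is represented by a Cauchy sequence \<open>f\<close> that converges to \<open>u\<close> in
  \<open>L\<^sup>1\<^sub>l\<^sub>o\<^sub>c(\<Omega>)\<close>.
\<close>

definition S0_approx ::
  "('m::{t2_space, second_countable_topology}, 'n::finite) chart set \<Rightarrow> 'm measure
     \<Rightarrow> ('k::finite \<Rightarrow> ('m, 'n) chart \<Rightarrow> real ^ 'n \<Rightarrow> real ^ 'n) \<Rightarrow> 'm set \<Rightarrow> real
     \<Rightarrow> (nat \<Rightarrow> 'm \<Rightarrow> real) \<Rightarrow> ('m \<Rightarrow> real) \<Rightarrow> bool" where
  "S0_approx A \<mu> X \<Omega> p f u \<longleftrightarrow>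
     (\<forall>i. f i \<in> C0k A 1 \<Omega>) \<and>
     (\<forall>\<epsilon>>0. \<exists>m. \<forall>i\<ge>m. \<forall>j\<ge>m. J_norm A \<mu> X \<Omega> p (\<lambda>x. f i x - f j x) < \<epsilon>) \<and>
     set_borel_measurable \<mu> \<Omega> u \<and>
     (\<forall>K. compact K \<and> K \<subseteq> \<Omega> \<longrightarrow>
        (\<lambda>i. \<integral>\<^sup>+ x\<in>K. ennreal \<bar>f i x - u x\<bar> \<partial>\<mu>) \<longlonglongrightarrow> 0)"

definition S0_space ::
  "('m::{t2_space, second_countable_topology}, 'n::finite) chart set \<Rightarrow> 'm measure
     \<Rightarrow> ('k::finite \<Rightarrow> ('m, 'n) chart \<Rightarrow> real ^ 'n \<Rightarrow> real ^ 'n) \<Rightarrow> 'm set \<Rightarrow> real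
     \<Rightarrow> ('m \<Rightarrow> real) set" where
  "S0_space A \<mu> X \<Omega> p = {u. \<exists>f. S0_approx A \<mu> X \<Omega> p f u}"

text \<open>
  \<open>g\<close> is \<open>\<nabla>\<^sub>X u\<close> for \<open>u\<close> in the completion, namely the \<open>L\<^sup>p\<close> limit of the gradients of an
  approximating sequence. It exists because \<open>L\<^sup>p\<close> is complete, and it is unique almost everywhere:
  integrating by parts against the formal adjoints shows that it is the distributional gradient
  of \<open>u\<close>.
\<close>

definition has_X_grad ::
  "('m::{t2_space, second_countable_topology}, 'n::finite) chart set \<Rightarrow> 'm measure
     \<Rightarrow> ('k::finite \<Rightarrow> ('m, 'n) chart \<Rightarrow> real ^ 'n \<Rightarrow> real ^ 'n) \<Rightarrow> 'm set \<Rightarrow> real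
     \<Rightarrow> ('m \<Rightarrow> real) \<Rightarrow> ('m \<Rightarrow> real ^ 'k) \<Rightarrow> bool" where
  "has_X_grad A \<mu> X \<Omega> p u g \<longleftrightarrow>
     set_borel_measurable \<mu> \<Omega> g \<and>
     (\<exists>f. S0_approx A \<mu> X \<Omega> p f u \<and>
        (\<lambda>i. \<integral>\<^sup>+ x\<in>\<Omega>. ennreal (norm (X_grad A X (f i) x - g x) powr p) \<partial>\<mu>) \<longlonglongrightarrow> 0)"

section \<open>Sub-solutions of the Dirichlet problem\<close>

text \<open>
  The first integrand is integrable by Hoelder's inequality. The second need not be, since the
  completion need not embed into \<open>L\<^sup>p(\<Omega>)\<close>, so its integrability is part of the definition; the
  factor \<open>lam\<close> inside \<open>set_integrable\<close> makes this void for \<open>lam = 0\<close>.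
\<close>

definition sub_solution ::
  "('m::{t2_space, second_countable_topology}, 'n::finite) chart set \<Rightarrow> 'm measure
     \<Rightarrow> ('k::finite \<Rightarrow> ('m, 'n) chart \<Rightarrow> real ^ 'n \<Rightarrow> real ^ 'n) \<Rightarrow> 'm set \<Rightarrow> real \<Rightarrow> real
     \<Rightarrow> ('m \<Rightarrow> real) \<Rightarrow> bool" where
  "sub_solution A \<mu> X \<Omega> p lam u \<longleftrightarrow>
     u \<in> S0_space A \<mu> X \<Omega> p \<and>
     (\<forall>g \<phi> h. has_X_grad A \<mu> X \<Omega> p u g \<and> has_X_grad A \<mu> X \<Omega> p \<phi> h \<and>
        (AE x in \<mu>. x \<in> \<Omega> \<longrightarrow> 0 \<le> \<phi> x) \<longrightarrow>
        set_integrable \<mu> \<Omega> (\<lambda>x. lam * (\<bar>u x\<bar> powr (p - 2) * u x * \<phi> x)) \<and>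
        (LINT x:\<Omega>|\<mu>. norm (g x) powr (p - 2) * (g x \<bullet> h x))
          - lam * (LINT x:\<Omega>|\<mu>. \<bar>u x\<bar> powr (p - 2) * u x * \<phi> x) \<le> 0)"

text \<open>
  Integral over \<open>\<Omega>\<close> of a nonnegative function, with value in \<open>[0, \<infinity>]\<close>. Note that
  \<open>\<infinity> + -\<infinity> = \<infinity>\<close> in \<open>ereal\<close>.
\<close>

definition ext_integral :: "'m measure \<Rightarrow> 'm set \<Rightarrow> ('m \<Rightarrow> real) \<Rightarrow> ereal" where
  "ext_integral \<mu> \<Omega> f = enn2ereal (\<integral>\<^sup>+ x\<in>\<Omega>. ennreal (f x) \<partial>\<mu>)"

end

theory Submission
  imports Defs
begin

text \<open>
  Put \<open>s = q - p + 1\<close>. Formally one tests the inequality with \<open>\<phi>\<^sup>p v\<^sup>s\<close> and absorbs the mixed term by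
  Young's inequality. To make the test function admissible, \<open>v\<^sup>s\<close> is replaced by \<open>G (v + 1/n)\<close>, where
  \<open>G x = (x powr (- s / (p - 1)) + 1/n) powr (- (p - 1))\<close> is bounded and increases to \<open>x\<^sup>s\<close>. Young's inequality produces
  \<open>G powr p / G' powr (p - 1)\<close>, which for this \<open>G\<close> is exactly \<open>s powr (1 - p) * x powr q\<close>, so the truncation costs nothing, and
  \<open>n \<rightarrow> \<infinity>\<close> is Fatou's lemma on the left and dominated convergence on the right.
\<close>

section \<open>Calculus of the truncated power\<close>

text \<open>The obstacle to truncating is the absorption: Young's inequality can hide the mixed term
  only where the truncated function has a positive derivative, so capping \<open>x powr s\<close> at
  a constant fails, because the mixed term survives on the flat part. One asks instead that
  \<open>G powr p / G' powr (p - 1)\<close> equal \<open>s powr (1 - p) * x powr q\<close>. This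
  equation is separable, \<open>G powr (- p / (p - 1)) * G' = s * x powr (- q / (p - 1))\<close>,
  and integrates to \<open>G powr (- 1 / (p - 1)) = x powr (- s / (p - 1)) + c\<close>. The
  truncation parameter is the constant of integration: every \<open>c > 0\<close> caps
  \<open>G\<close> at \<open>c powr (- (p - 1))\<close>. The constant of the theorem arises as
  follows: the fraction \<open>(p - 1) / p\<close> of the energy is absorbed, and dividing by the
  remaining \<open>1 / p\<close> and by \<open>s\<close> turns \<open>(p / s) powr (p - 1)\<close>
  into \<open>(p / s) powr p\<close>. A second obstacle is that no integral in the conclusion is
  known to be finite. Hence \<open>lam\<close> is split by sign, each part stays on the side where
  it is nonnegative, and the limit is taken in \<open>[0, \<infinity>]\<close>.\<close>

lemma has_real_derivative_glue:
  fixes f g :: "real \<Rightarrow> real"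
  assumes f: "\<And>t. t \<le> 0 \<Longrightarrow> (f has_real_derivative f' t) (at t)"
    and g: "\<And>t. t \<ge> 0 \<Longrightarrow> (g has_real_derivative g' t) (at t)"
    and eq: "f 0 = g 0" "f' 0 = g' 0"
  shows "((\<lambda>t. if t \<le> 0 then f t else g t) has_real_derivative (if t \<le> 0 then f' t else g' t)) (at t)"
proof -
  have cl: "closure {..0} \<inter> closure {0<..} = {0::real}" by auto
  have F: "(f has_derivative (*) (f' t)) (at t within S)" if "t \<le> 0" for t S
    using f[OF that] by (auto simp: has_field_derivative_def intro: has_derivative_at_withinI)
  have G: "(g has_derivative (*) (g' t)) (at t within S)" if "0 \<le> t" for t S
    using g[OF that] by (auto simp: has_field_derivative_def intro: has_derivative_at_withinI)
  have "((\<lambda>t. if t \<in> {..0} then f t else g t) has_derivative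
      (if t \<in> {..0} then (*) (f' t) else (*) (g' t))) (at t within {..0} \<union> {0<..})"
  proof (rule has_derivative_If_within_closures[where f' = "\<lambda>t. (*) (f' t)" and g' = "\<lambda>t. (*) (g' t)"])
    show "t \<in> {..0} \<union> {0<..}" by auto
  qed (use F G eq in \<open>auto simp: cl\<close>)
  moreover have "{..0} \<union> {0<..} = (UNIV :: real set)" by auto
  ultimately show ?thesis by (cases "t \<le> 0") (simp_all add: has_field_derivative_def)
qed

text \<open>The chain rule below asks for a function that is continuously differentiable on the
  whole line, while a nonnegative \<open>\<phi>\<close> takes the value 0, where the usual power
  rule stops. The absolute value continues the power evenly across 0, and \<open>p - 1 > 0\<close>
  makes both the difference quotient and the derivative tend to 0 there.\<close>

lemma
  fixes p :: real
  assumes p: "1 < p"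
  shows has_real_derivative_abs_powr:
      "((\<lambda>t. \<bar>t\<bar> powr p) has_real_derivative p * sgn t * \<bar>t\<bar> powr (p - 1)) (at t)"
    and continuous_on_abs_powr_derivative:
      "continuous_on UNIV (\<lambda>t. p * sgn t * \<bar>t\<bar> powr (p - 1))"
proof -
  have tend: "((\<lambda>t::real. \<bar>t\<bar> powr (p - 1)) \<longlongrightarrow> 0) (at 0)"
    using p by (intro tendsto_zero_powrI[where b = "p - 1"] tendsto_rabs_zero tendsto_ident_at) auto
  show deriv: "((\<lambda>t. \<bar>t\<bar> powr p) has_real_derivative p * sgn t * \<bar>t\<bar> powr (p - 1)) (at t)" for t :: real
  proof (cases t "0 :: real" rule: linorder_cases)
    case less
    have "((\<lambda>t. (- t) powr p) has_real_derivative p * sgn t * \<bar>t\<bar> powr (p - 1)) (at t)"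
      using less by (auto intro!: derivative_eq_intros simp: powr_diff field_simps)
    then show ?thesis
      using less by (elim has_field_derivative_transform_within_open[where S = "{..<0}"]) auto
  next
    case equal
    have "((\<lambda>t::real. \<bar>t\<bar> powr p / t) \<longlongrightarrow> 0) (at 0)"
    proof (rule Lim_null_comparison[OF _ tend])
      have "norm (\<bar>t\<bar> powr p / t) \<le> \<bar>t\<bar> powr (p - 1)" if "t \<noteq> 0" for t :: real
        using that by (simp add: powr_diff)
      then show "\<forall>\<^sub>F t in at 0. norm (\<bar>t\<bar> powr p / t) \<le> \<bar>t\<bar> powr (p - 1)"
        by (simp add: eventually_at_filter)
    qed
    then show ?thesis
      using equal p by (simp add: has_field_derivative_iff)
  next
    case greater
    have "((\<lambda>t. t powr p) has_real_derivative p * sgn t * \<bar>t\<bar> powr (p - 1)) (at t)"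
      using greater has_real_derivative_powr[of t p] by simp
    then show ?thesis
      using greater by (elim has_field_derivative_transform_within_open[where S = "{0<..}"]) auto
  qed
  show "continuous_on UNIV (\<lambda>t. p * sgn t * \<bar>t\<bar> powr (p - 1))"
  proof (rule continuous_at_imp_continuous_on, rule ballI)
    fix t :: real
    show "isCont (\<lambda>t. p * sgn t * \<bar>t\<bar> powr (p - 1)) t"
    proof (cases "t = 0")
      case True
      have "((\<lambda>t::real. p * sgn t * \<bar>t\<bar> powr (p - 1)) \<longlongrightarrow> 0) (at 0)"
      proof (rule Lim_null_comparison[OF _ tendsto_mult_right_zero[OF tend, of p]])
        show "\<forall>\<^sub>F t in at 0. norm (p * sgn t * \<bar>t\<bar> powr (p - 1)) \<le> p * \<bar>t\<bar> powr (p - 1)"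
          using p by (intro always_eventually) (auto simp: abs_mult sgn_if)
      qed
      then show ?thesis using True by (simp add: isCont_def)
    next
      case False
      then show ?thesis by (intro continuous_intros) auto
    qed
  qed
qed

text \<open>
  For every \<open>c\<close> this solves the differential equation saying that
  \<open>trunc powr p / trunc' powr (p - 1)\<close> is the same multiple of \<open>x powr (s + p - 1)\<close> as for \<open>c = 0\<close>,
  where \<open>trunc\<close> is \<open>x powr s\<close>.
\<close>

definition trunc :: "real \<Rightarrow> real \<Rightarrow> real \<Rightarrow> real \<Rightarrow> real" where
  "trunc p s c x = (x powr (- (s / (p - 1))) + c) powr (- (p - 1))"

definition trunc' :: "real \<Rightarrow> real \<Rightarrow> real \<Rightarrow> real \<Rightarrow> real" where
  "trunc' p s c x = s * x powr (- (s / (p - 1)) - 1) * (x powr (- (s / (p - 1))) + c) powr (- p)"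

lemma powr_add_pos: "0 < x \<Longrightarrow> 0 \<le> c \<Longrightarrow> 0 < x powr r + (c :: real)"
  by (simp add: add_pos_nonneg)

lemma trunc_pos:
  assumes "0 < x" "0 \<le> c" shows "0 < trunc p s c x"
  using powr_add_pos[OF assms, of "- (s / (p - 1))"] by (simp add: trunc_def)

lemma trunc'_pos:
  assumes "0 < x" "0 \<le> c" "0 < s" shows "0 < trunc' p s c x"
  using powr_add_pos[OF assms(1,2), of "- (s / (p - 1))"] assms by (simp add: trunc'_def)

lemma exponent_cancel: "1 < p \<Longrightarrow> - (s / (p - 1)) * - (p - 1) = (s :: real)"
  by (simp add: field_simps)

lemma trunc_deriv:
  assumes "1 < p" "0 < x" "0 \<le> c"
  shows "(trunc p s c has_real_derivative trunc' p s c x) (at x)"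
proof -
  define r where "r = - (s / (p - 1))"
  have pos: "0 < x powr r + c" using assms by (intro powr_add_pos)
  have "((\<lambda>x. x powr r + c) has_real_derivative r * x powr (r - 1)) (at x)"
    using DERIV_add[OF has_real_derivative_powr[OF assms(2)] DERIV_const] by simp
  from DERIV_chain2[OF has_real_derivative_powr[OF pos] this]
  have "((\<lambda>x. (x powr r + c) powr (- (p - 1))) has_real_derivative
      - (p - 1) * (x powr r + c) powr (- (p - 1) - 1) * (r * x powr (r - 1))) (at x)" .
  moreover have "- (p - 1) * (x powr r + c) powr (- (p - 1) - 1) * (r * x powr (r - 1))
      = s * x powr (r - 1) * (x powr r + c) powr (- p)"
  proof -
    have "- (p - 1) - 1 = - p" "r * (p - 1) = - s"
      using assms(1) by (simp_all add: r_def)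
    moreover have "- (p - 1) * a * (r * b) = - (r * (p - 1)) * b * a" for a b :: real
      by (simp add: algebra_simps)
    ultimately show ?thesis by simp
  qed
  ultimately show ?thesis
    by (simp add: trunc_def[abs_def] trunc'_def r_def)
qed

lemma trunc_le_powr:
  assumes "1 < p" "0 < x" "0 \<le> c"
  shows "trunc p s c x \<le> x powr s"
proof -
  have "trunc p s c x \<le> (x powr (- (s / (p - 1)))) powr (- (p - 1))"
    unfolding trunc_def using assms by (intro powr_mono2') auto
  then show ?thesis using assms(1) by (simp only: powr_powr exponent_cancel)
qed

lemma trunc_le:
  assumes "1 < p" "0 < c"
  shows "trunc p s c x \<le> c powr (- (p - 1))"
  unfolding trunc_def using assms by (intro powr_mono2') auto

lemma trunc'_le:
  assumes "1 < p" "0 < c" "0 < s" "0 < y" "y \<le> x"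
  shows "trunc' p s c x \<le> s * y powr (- (s / (p - 1)) - 1) * c powr (- p)"
proof -
  have "0 < s / (p - 1)" using assms by simp
  then have "- 1 \<le> s / (p - 1)" by linarith
  then show ?thesis
    unfolding trunc'_def using assms by (intro mult_mono powr_mono2') auto
qed

text \<open>Both powers contain the same factor, the base
  \<open>x powr (- (s / (p - 1))) + c\<close> with exponent \<open>- (p * (p - 1))\<close>. It
  cancels, and with it all dependence on \<open>c\<close>.\<close>

lemma trunc_ratio:
  assumes "1 < p" "0 < x" "0 \<le> c" "0 < s"
  shows "trunc p s c x powr p / trunc' p s c x powr (p - 1) = x powr (s + p - 1) / s powr (p - 1)"
proof -
  define y where "y = x powr (- (s / (p - 1))) + c"
  have y: "0 < y" using assms by (simp add: y_def add_pos_nonneg)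
  define Y where "Y = y powr (- (p * (p - 1)))"
  have Y: "Y \<noteq> 0" using y by (simp add: Y_def)
  have "- (p - 1) * p = - (p * (p - 1))" "- p * (p - 1) = - (p * (p - 1))"
    by (simp_all add: algebra_simps)
  then have *: "(y powr - (p - 1)) powr p = Y" "(y powr - p) powr (p - 1) = Y"
    unfolding Y_def powr_powr by simp_all
  have "(- (s / (p - 1)) - 1) * (p - 1) = - (s + p - 1)"
    using assms by (simp add: field_simps)
  then have **: "(x powr (- (s / (p - 1)) - 1)) powr (p - 1) = inverse (x powr (s + p - 1))"
    unfolding powr_powr by (simp only: powr_minus)
  have "trunc p s c x powr p = Y"
    unfolding trunc_def y_def[symmetric] by (rule *)
  moreover have "trunc' p s c x powr (p - 1) = s powr (p - 1) * inverse (x powr (s + p - 1)) * Y"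
    unfolding trunc'_def y_def[symmetric] using assms y by (simp add: powr_mult * **)
  ultimately show ?thesis
    using Y by (simp add: field_simps)
qed

text \<open>Weighted Young inequality with the conjugate exponents \<open>p / (p - 1)\<close> and
  \<open>p\<close>. In the application \<open>y\<close> is \<open>\<phi>\<close> times the length of
  the gradient of \<open>v\<close>, and \<open>z\<close> is the length of the gradient of
  \<open>\<phi>\<close>.\<close>

lemma trunc_Young:
  assumes p: "1 < p" and x: "0 < x" and c: "0 \<le> c" and s: "0 < s" and y: "0 \<le> y" and z: "0 \<le> z"
  shows "p * trunc p s c x * y powr (p - 1) * z
    \<le> (p - 1) / p * trunc' p s c x * y powr p + (p / s) powr (p - 1) * x powr (s + p - 1) * z powr p"
proof -
  let ?G = "trunc p s c x" and ?D = "trunc' p s c x"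
  have G: "0 < ?G" and D: "0 < ?D" using trunc_pos trunc'_pos x c s by auto
  define r where "r = p / (p - 1)"
  have r: "1 < r" "1 / r + 1 / p = 1" "(p - 1) * r = p"
    using p by (auto simp: r_def field_simps)
  \<comment> \<open>A weight \<open>t * ?D\<close> absorbs the fraction \<open>(p - 1) * t\<close>
    and leads to the constant \<open>t powr (1 - p) / (1 - (p - 1) * t)\<close>, which is smallest
    at \<open>t = 1 / p\<close>.\<close>
  define d where "d = ?D / p"
  have d: "0 < d" using D p by (simp add: d_def)
  define a where "a = d powr (1 / r) * y powr (p - 1)"
  define b where "b = ?G * d powr (- (1 / r)) * z"
  have ab: "a * b = ?G * y powr (p - 1) * z"
    unfolding a_def b_def using d by (simp add: powr_minus)
  have ar: "a powr r = d * y powr p"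
    unfolding a_def using d y r by (simp add: powr_mult powr_powr)
  have bp: "b powr p = (p / s) powr (p - 1) * x powr (s + p - 1) * z powr p"
  proof -
    have "p * (1 / r) = p - 1" using p by (simp add: r_def)
    then have "b powr p = ?G powr p * d powr (- (p - 1)) * z powr p"
      unfolding b_def using d G z p by (simp add: powr_mult powr_powr mult.commute)
    also have "?G powr p * d powr (- (p - 1)) = p powr (p - 1) * (?G powr p / ?D powr (p - 1))"
      unfolding d_def powr_minus using D p by (simp add: powr_divide)
    also have "\<dots> = (p / s) powr (p - 1) * x powr (s + p - 1)"
      unfolding trunc_ratio[OF p x c s] using p s by (simp add: powr_divide)
    finally show ?thesis .
  qed
  have "a * b \<le> a powr r / r + b powr p / p"
    using d y z G by (intro Youngs_inequality r p) (auto simp: a_def b_def)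
  then have "p * (a * b) \<le> p * (a powr r / r + b powr p / p)"
    using p by (intro mult_left_mono) auto
  also have "\<dots> = (p - 1) * a powr r + b powr p"
    using p by (simp add: r_def field_simps)
  finally show ?thesis
    unfolding ab ar bp by (simp add: d_def mult_ac)
qed

text \<open>Argument and parameter converge together because one null sequence later serves both as
  truncation parameter and as shift.\<close>

lemma trunc_tendsto:
  assumes "1 < p" "0 < x" "0 < s" "X \<longlonglongrightarrow> x" "c \<longlonglongrightarrow> 0"
  shows "(\<lambda>n. trunc p s (c n) (X n)) \<longlonglongrightarrow> x powr s"
    and "(\<lambda>n. trunc' p s (c n) (X n)) \<longlonglongrightarrow> s * x powr (s - 1)"
proof -
  have pow: "(\<lambda>n. X n powr b) \<longlonglongrightarrow> x powr b" for b
    using assms by (intro tendsto_powr tendsto_const) auto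
  have base: "(\<lambda>n. X n powr (- (s / (p - 1))) + c n) \<longlonglongrightarrow> x powr (- (s / (p - 1)))"
    using tendsto_add[OF pow assms(5)] by simp
  have "(\<lambda>n. trunc p s (c n) (X n)) \<longlonglongrightarrow> (x powr (- (s / (p - 1)))) powr (- (p - 1))"
    unfolding trunc_def using assms(2) by (intro tendsto_powr base tendsto_const) auto
  then show "(\<lambda>n. trunc p s (c n) (X n)) \<longlonglongrightarrow> x powr s"
    using assms(1) by (simp only: powr_powr exponent_cancel)
  have "(\<lambda>n. trunc' p s (c n) (X n)) \<longlonglongrightarrow>
      s * x powr (- (s / (p - 1)) - 1) * (x powr (- (s / (p - 1)))) powr (- p)"
    unfolding trunc'_def using assms(2) by (intro tendsto_intros base pow) auto
  moreover have "- (s / (p - 1)) - 1 + (- (s / (p - 1))) * (- p) = s - 1"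
  proof -
    have *: "- a - 1 + (- a) * (- p) = a * (p - 1) - 1" for a
      by (simp add: algebra_simps)
    show ?thesis unfolding * using assms(1) by simp
  qed
  ultimately show "(\<lambda>n. trunc' p s (c n) (X n)) \<longlonglongrightarrow> s * x powr (s - 1)"
    by (simp only: powr_powr mult.assoc powr_add[symmetric])
qed

text \<open>
  The argument is shifted by \<open>e\<close> to avoid the singularity at 0, and the shift is bent on the
  negative axis so that it stays above \<open>e / 2\<close>.
\<close>

lemma bent_shift:
  fixes e :: real
  assumes e: "0 < e"
  obtains u u' where "\<And>t. (u has_real_derivative u' t) (at t)" "continuous_on UNIV u'"
    "\<And>t. e / 2 \<le> u t" "\<And>t. 0 \<le> u' t" "\<And>t. u' t \<le> 1"
    "\<And>t. 0 \<le> t \<Longrightarrow> u t = t + e" "\<And>t. 0 \<le> t \<Longrightarrow> u' t = 1"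
proof
  \<comment> \<open>A Moebius function on the negative axis: value \<open>e\<close> and slope 1 at 0
    match the shift, and the limit at minus infinity is \<open>e / 2\<close>.\<close>
  let ?u = "\<lambda>t. if t \<le> 0 then e + e * t / (e - 2 * t) else t + e"
  let ?u' = "\<lambda>t. if t \<le> 0 then e\<^sup>2 / (e - 2 * t)\<^sup>2 else 1"
  have pos: "0 < e - 2 * t" if "t \<le> 0" for t using e that by linarith
  show "(?u has_real_derivative ?u' t) (at t)" for t
  proof (rule has_real_derivative_glue)
    fix t :: real assume t: "t \<le> 0"
    show "((\<lambda>t. e + e * t / (e - 2 * t)) has_real_derivative e\<^sup>2 / (e - 2 * t)\<^sup>2) (at t)"
      using pos[OF t]
      by (auto intro!: derivative_eq_intros simp: power2_eq_square field_simps)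
  qed (use e in \<open>auto intro!: derivative_eq_intros simp: power2_eq_square\<close>)
  have "continuous_on ({..0} \<union> {0..}) ?u'"
    using pos e by (intro continuous_on_If continuous_intros) (auto simp: power2_eq_square)
  moreover have "{..0} \<union> {0..} = (UNIV :: real set)" by auto
  ultimately show "continuous_on UNIV ?u'" by simp
  show "e / 2 \<le> ?u t" for t
    using pos[of t] e by (auto simp: divide_simps) (auto simp: algebra_simps)
  show "0 \<le> ?u' t" for t by simp
  show "?u' t \<le> 1" for t
    using pos[of t] e by (auto simp: divide_simps intro!: power_mono)
qed (use e in \<open>auto simp: power2_eq_square\<close>)

text \<open>The approximants of \<open>v\<close> may be negative although \<open>v\<close> is
  positive, so the truncated power has to be extended to the whole line. Composition with the bent
  shift does this and keeps the argument above \<open>e / 2\<close>, where the derivative is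
  bounded.\<close>

lemma trunc_test_function:
  assumes p: "1 < p" and s: "0 < s" and c: "0 < c" and e: "0 < e"
  obtains H H' B where "\<And>t. (H has_real_derivative H' t) (at t)" "continuous_on UNIV H'"
    "\<And>t. 0 < H t" "\<And>t. \<bar>H t\<bar> \<le> B" "\<And>t. \<bar>H' t\<bar> \<le> B"
    "\<And>t. 0 \<le> t \<Longrightarrow> H t = trunc p s c (t + e)" "\<And>t. 0 \<le> t \<Longrightarrow> H' t = trunc' p s c (t + e)"
proof -
  obtain u u' where u: "\<And>t. (u has_real_derivative u' t) (at t)" "continuous_on UNIV u'"
    "\<And>t. e / 2 \<le> u t" "\<And>t. 0 \<le> u' t" "\<And>t. u' t \<le> 1"
    "\<And>t. 0 \<le> t \<Longrightarrow> u t = t + e" "\<And>t. 0 \<le> t \<Longrightarrow> u' t = 1"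
    using bent_shift[OF e] by metis
  have u_pos: "0 < u t" for t using u(3)[of t] e by linarith
  have u_cont: "continuous_on UNIV u"
    using u(1) by (meson DERIV_isCont continuous_at_imp_continuous_on)
  \<comment> \<open>The first entry bounds the function, whose base is at least \<open>c\<close>.
    The second bounds the derivative: there the base is at least \<open>c\<close>, the argument at
    least \<open>e / 2\<close>, both exponents are negative, and \<open>u'\<close> contributes at
    most 1.\<close>
  define B where "B = max (c powr (- (p - 1))) (s * (e / 2) powr (- (s / (p - 1)) - 1) * c powr (- p))"
  show thesis
  proof
    show "((\<lambda>t. trunc p s c (u t)) has_real_derivative trunc' p s c (u t) * u' t) (at t)" for t
      by (rule DERIV_chain2[OF trunc_deriv u(1)]) (use p u_pos c in auto)
    have "u t powr (- (s / (p - 1))) + c \<noteq> 0" for t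
      using c by (metis add_nonneg_pos less_irrefl powr_ge_zero)
    then show "continuous_on UNIV (\<lambda>t. trunc' p s c (u t) * u' t)"
      unfolding trunc'_def using u_pos by (intro continuous_intros u_cont u(2)) (auto simp: less_imp_neq[symmetric])
    show pos: "0 < trunc p s c (u t)" for t using u_pos c by (intro trunc_pos) auto
    show "\<bar>trunc p s c (u t)\<bar> \<le> B" for t
      using pos[of t] trunc_le[OF p c, of s "u t"] by (simp add: B_def)
    show "\<bar>trunc' p s c (u t) * u' t\<bar> \<le> B" for t
    proof -
      have D: "0 < trunc' p s c (u t)" using u_pos c s by (intro trunc'_pos) auto
      then have "trunc' p s c (u t) * u' t \<le> trunc' p s c (u t)"
        using u(5)[of t] by (simp add: mult_left_le)
      also have "\<dots> \<le> B"
        using trunc'_le[OF p c s _ u(3)] e by (simp add: B_def le_max_iff_disj)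
      finally show ?thesis using D u(4)[of t] by simp
    qed
  qed (simp_all add: u(6,7))
qed

section \<open>Vector fields in charts\<close>

lemma Ck_on_1_iff:
  assumes "open S"
  shows "Ck_on 1 S f \<longleftrightarrow> (\<forall>y\<in>S. f differentiable at y) \<and>
    (\<forall>e. continuous_on S (\<lambda>y. frechet_derivative f (at y) e))"
  using assms by (auto simp: differentiable_on_eq_differentiable_at)

locale vector_field_family =
  fixes A :: "('m::{t2_space, second_countable_topology}, 'n::finite) chart set"
    and w :: "('m, 'n) chart \<Rightarrow> real ^ 'n \<Rightarrow> real"
    and \<mu> :: "'m measure"
    and X :: "'k::finite \<Rightarrow> ('m, 'n) chart \<Rightarrow> real ^ 'n \<Rightarrow> real ^ 'n"
  assumes atlas: "smooth_atlas A"
    and vol: "volume_form A w"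
    and vol_measure: "volume_measure A w \<mu>"
    and fields: "smooth_vector_field A (X k)"
begin

text \<open>The support condition of \<open>C0k\<close> is left out because it is lost under
  composition: \<open>H (u x)\<close> with \<open>H\<close> positive never vanishes. Compact support
  returns only with the factor \<open>\<psi>\<close>.\<close>

definition C1 :: "('m \<Rightarrow> real) \<Rightarrow> bool" where
  "C1 u \<longleftrightarrow> (\<forall>c\<in>A. Ck_on 1 (chart_image c) (local_rep c u))"

lemma chart_exists: obtains c where "c \<in> A" "x \<in> fst c"
  using atlas unfolding smooth_atlas_def by blast

lemma open_chart: "c \<in> A \<Longrightarrow> open (fst c)"
  and open_chart_image: "c \<in> A \<Longrightarrow> open (chart_image c)"
  and chart_homeo: "c \<in> A \<Longrightarrow>
    homeomorphism (fst c) (chart_image c) (snd c) (inv_into (fst c) (snd c))"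
  and coord_change_smooth: "c \<in> A \<Longrightarrow> d \<in> A \<Longrightarrow> smooth_on (overlap c d) (coord_change c d)"
  using atlas unfolding smooth_atlas_def by blast+

lemma chart_inverse: "c \<in> A \<Longrightarrow> x \<in> fst c \<Longrightarrow> inv_into (fst c) (snd c) (snd c x) = x"
  using chart_homeo homeomorphism_apply1 by blast

lemma snd_in_chart_image: "x \<in> fst c \<Longrightarrow> snd c x \<in> chart_image c"
  by (simp add: chart_image_def)

lemma continuous_on_chart: "c \<in> A \<Longrightarrow> continuous_on (fst c) (snd c)"
  using chart_homeo homeomorphism_cont1 by blast

lemma local_rep_chart: "c \<in> A \<Longrightarrow> x \<in> fst c \<Longrightarrow> local_rep c u (snd c x) = u x"
  by (simp add: local_rep_def chart_inverse)

lemma open_chart_subset_image: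
  assumes "c \<in> A" "open B" "B \<subseteq> fst c" shows "open (snd c ` B)"
proof -
  have "openin (top_of_set (chart_image c)) (snd c ` B)"
    using homeomorphism_imp_open_map[OF chart_homeo[OF assms(1)]] assms
    by (simp add: open_subset)
  then show ?thesis
    using open_chart_image[OF assms(1)] openin_open_trans by blast
qed

lemma open_overlap: "c \<in> A \<Longrightarrow> d \<in> A \<Longrightarrow> open (overlap c d)"
  unfolding overlap_def by (intro open_chart_subset_image open_Int open_chart) auto

section \<open>Chart independence of the derivative along a vector field\<close>

lemma C1_differentiable:
  "C1 u \<Longrightarrow> c \<in> A \<Longrightarrow> x \<in> fst c \<Longrightarrow> local_rep c u differentiable at (snd c x)"
  by (metis C1_def Ck_on_1_iff open_chart_image snd_in_chart_image)

text \<open>The chain rule for the coordinate change cancels against the transformation law of the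
  field. This frees all later computations from the chart that \<open>SOME\<close> picks.\<close>

lemma vf_apply_in_chart:
  assumes "C1 u" "c \<in> A" "x \<in> fst c"
  shows "vf_apply A (X k) u x =
    frechet_derivative (local_rep c u) (at (snd c x)) (X k c (snd c x))"
proof -
  define d where "d = (SOME c. c \<in> A \<and> x \<in> fst c)"
  have d: "d \<in> A" "x \<in> fst d"
    using someI[of "\<lambda>c. c \<in> A \<and> x \<in> fst c" c] assms unfolding d_def by auto
  let ?y = "snd c x" and ?T = "coord_change c d"
  have y: "?y \<in> overlap c d" using assms d by (auto simp: overlap_def)
  have Ty: "?T ?y = snd d x"
    using assms by (simp add: coord_change_def local_rep_chart)
  have "smooth_on (overlap c d) ?T" using coord_change_smooth assms d by blast
  then have "Ck_on 1 (overlap c d) ?T" unfolding smooth_on_def by blast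
  then have T: "(?T has_derivative frechet_derivative ?T (at ?y)) (at ?y)"
    using Ck_on_1_iff[OF open_overlap] assms d y frechet_derivative_works by blast
  have "(local_rep d u has_derivative frechet_derivative (local_rep d u) (at (?T ?y))) (at (?T ?y))"
    unfolding Ty using C1_differentiable[OF assms(1) d] frechet_derivative_works by blast
  from diff_chain_at[OF T this]
  have comp: "(local_rep d u \<circ> ?T has_derivative
      frechet_derivative (local_rep d u) (at (snd d x)) \<circ> frechet_derivative ?T (at ?y)) (at ?y)"
    unfolding Ty .
  \<comment> \<open>The two representatives are related by \<open>?T\<close> on the overlap only;
    since it is an open neighbourhood of \<open>?y\<close>, this determines the derivative.\<close>
  have eq: "(local_rep d u \<circ> ?T) z = local_rep c u z" if "z \<in> overlap c d" for z
  proof -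
    from that obtain x' where x': "x' \<in> fst c" "x' \<in> fst d" "z = snd c x'"
      by (auto simp: overlap_def)
    then show ?thesis
      using assms d by (simp add: coord_change_def local_rep_chart)
  qed
  have "(local_rep c u has_derivative
      frechet_derivative (local_rep d u) (at (snd d x)) \<circ> frechet_derivative ?T (at ?y)) (at ?y)"
    using has_derivative_transform_within_open[OF comp open_overlap y eq] assms d by blast
  then have "frechet_derivative (local_rep c u) (at ?y) =
      frechet_derivative (local_rep d u) (at (snd d x)) \<circ> frechet_derivative ?T (at ?y)"
    using frechet_derivative_at by metis
  moreover have "X k d (?T ?y) = frechet_derivative ?T (at ?y) (X k c ?y)"
    using fields[of k] assms d y unfolding smooth_vector_field_def by blast
  ultimately show ?thesis
    unfolding vf_apply_def Let_def d_def[symmetric] using Ty by simp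
qed

lemma vf_apply_eqI:
  assumes "C1 u" "c \<in> A" "x \<in> fst c" "(local_rep c u has_derivative D) (at (snd c x))"
  shows "vf_apply A (X k) u x = D (X k c (snd c x))"
  using vf_apply_in_chart[OF assms(1-3)] frechet_derivative_at[OF assms(4)] by simp

section \<open>Continuity of functions and gradients across charts\<close>

lemma C1_I:
  assumes "\<And>c y. c \<in> A \<Longrightarrow> y \<in> chart_image c \<Longrightarrow> (local_rep c u has_derivative D c y) (at y)"
    and "\<And>c e. c \<in> A \<Longrightarrow> continuous_on (chart_image c) (\<lambda>y. D c y e)"
  shows "C1 u"
  unfolding C1_def
proof
  fix c assume c: "c \<in> A"
  have "frechet_derivative (local_rep c u) (at y) = D c y" if "y \<in> chart_image c" for y
    using frechet_derivative_at[OF assms(1)[OF c that]] by simp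
  then show "Ck_on 1 (chart_image c) (local_rep c u)"
    unfolding Ck_on_1_iff[OF open_chart_image[OF c]]
    using assms c by (metis (mono_tags, lifting) continuous_on_cong differentiable_def)
qed

lemma C1_has_derivative:
  assumes "C1 u" "c \<in> A" "y \<in> chart_image c"
  shows "(local_rep c u has_derivative frechet_derivative (local_rep c u) (at y)) (at y)"
  using assms Ck_on_1_iff[OF open_chart_image] frechet_derivative_works unfolding C1_def by blast

lemma C1_continuous_derivative:
  assumes "C1 u" "c \<in> A"
  shows "continuous_on (chart_image c) (\<lambda>y. frechet_derivative (local_rep c u) (at y) e)"
  using assms Ck_on_1_iff[OF open_chart_image] unfolding C1_def by blast

lemma C1_continuous_local_rep:
  assumes "C1 u" "c \<in> A"
  shows "continuous_on (chart_image c) (local_rep c u)"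
  by (meson C1_has_derivative assms continuous_at_imp_continuous_on has_derivative_continuous)

lemma continuous_on_UNIV_chartwise:
  fixes F :: "'m \<Rightarrow> 'b::topological_space"
  assumes "\<And>c. c \<in> A \<Longrightarrow> continuous_on (fst c) F"
  shows "continuous_on UNIV F"
proof -
  have "continuous_on (\<Union>c\<in>A. fst c) F"
    using assms open_chart by (intro continuous_on_open_UN) auto
  then show ?thesis using atlas unfolding smooth_atlas_def by simp
qed

lemma C1_continuous: "C1 u \<Longrightarrow> continuous_on UNIV u"
proof (rule continuous_on_UNIV_chartwise)
  fix c assume u: "C1 u" and c: "c \<in> A"
  have "continuous_on (fst c) (\<lambda>x. local_rep c u (snd c x))"
    using C1_continuous_local_rep[OF u c]
    by (rule continuous_on_compose2[OF _ continuous_on_chart[OF c]])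
      (auto simp: chart_image_def)
  then show "continuous_on (fst c) u"
    using local_rep_chart[OF c] by (metis (mono_tags, lifting) continuous_on_cong)
qed

lemma X_grad_continuous:
  assumes "C1 u" shows "continuous_on UNIV (X_grad A X u)"
proof (rule continuous_on_UNIV_chartwise)
  fix c assume c: "c \<in> A"
  let ?D = "\<lambda>y. frechet_derivative (local_rep c u) (at y)"
  have cont: "continuous_on (chart_image c) (\<lambda>y. ?D y (X k c y))" for k
  proof -
    have "smooth_on (chart_image c) (X k c)"
      using fields[of k] c unfolding smooth_vector_field_def by blast
    then have "continuous_on (chart_image c) (X k c)"
      unfolding smooth_on_def using Ck_on.simps(1) by blast
    \<comment> \<open>Continuous differentiability was stated for fixed directions, whereas
      \<open>X k c y\<close> moves with \<open>y\<close>; expanding it in the coordinate basis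
      reduces the claim to finitely many fixed directions.\<close>
    then have "continuous_on (chart_image c) (\<lambda>y. \<Sum>j\<in>UNIV. X k c y $ j * ?D y (axis j 1))"
      by (intro continuous_intros C1_continuous_derivative assms c)
    moreover have "?D y (X k c y) = (\<Sum>j\<in>UNIV. X k c y $ j * ?D y (axis j 1))"
      if "y \<in> chart_image c" for y
    proof -
      interpret linear "?D y"
        using C1_has_derivative[OF assms c that] has_derivative_linear by blast
      have "?D y (X k c y) = ?D y (\<Sum>j\<in>UNIV. X k c y $ j *\<^sub>R axis j 1)"
        using basis_expansion[of "X k c y"] by (simp add: scalar_mult_eq_scaleR)
      then show ?thesis by (simp add: sum scaleR)
    qed
    ultimately show ?thesis by (metis (mono_tags, lifting) continuous_on_cong)
  qed
  have "continuous_on (fst c) (\<lambda>x. ?D (snd c x) (X k c (snd c x)))" for k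
    using cont by (rule continuous_on_compose2[OF _ continuous_on_chart[OF c]])
      (auto simp: chart_image_def)
  then have "continuous_on (fst c) (\<lambda>x. \<chi> k. ?D (snd c x) (X k c (snd c x)))"
    by (intro continuous_intros)
  then show "continuous_on (fst c) (X_grad A X u)"
    unfolding X_grad_def using vf_apply_in_chart[OF assms c]
    by (metis (mono_tags, lifting) Cart_lambda_cong continuous_on_cong)
qed

section \<open>Difference, product and chain rules for the gradient\<close>

lemma C1_diff:
  assumes "C1 u" "C1 v" shows "C1 (\<lambda>x. u x - v x)"
proof (rule C1_I)
  fix c y assume "c \<in> A" "y \<in> chart_image c"
  then show "(local_rep c (\<lambda>x. u x - v x) has_derivative (\<lambda>e.
      frechet_derivative (local_rep c u) (at y) e - frechet_derivative (local_rep c v) (at y) e)) (at y)"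
    using has_derivative_diff[OF C1_has_derivative[OF assms(1)] C1_has_derivative[OF assms(2)]]
    by (simp add: local_rep_def o_def)
next
  fix c e assume "c \<in> A"
  then show "continuous_on (chart_image c) (\<lambda>y.
      frechet_derivative (local_rep c u) (at y) e - frechet_derivative (local_rep c v) (at y) e)"
    by (intro continuous_intros C1_continuous_derivative assms)
qed

lemma X_grad_diff:
  assumes "C1 u" "C1 v"
  shows "X_grad A X (\<lambda>x. u x - v x) x = X_grad A X u x - X_grad A X v x"
proof -
  obtain c where c: "c \<in> A" "x \<in> fst c" by (rule chart_exists)
  then have y: "snd c x \<in> chart_image c" by (simp add: snd_in_chart_image)
  have "(local_rep c (\<lambda>x. u x - v x) has_derivative (\<lambda>e.
      frechet_derivative (local_rep c u) (at (snd c x)) e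
      - frechet_derivative (local_rep c v) (at (snd c x)) e)) (at (snd c x))"
    using has_derivative_diff[OF C1_has_derivative[OF assms(1) c(1) y] C1_has_derivative[OF assms(2) c(1) y]]
    by (simp add: local_rep_def o_def)
  from vf_apply_eqI[OF C1_diff[OF assms] c this] show ?thesis
    using assms c by (simp add: X_grad_def vec_eq_iff vf_apply_in_chart)
qed

lemma C1_mult:
  assumes "C1 u" "C1 v" shows "C1 (\<lambda>x. u x * v x)"
proof (rule C1_I)
  fix c y assume "c \<in> A" "y \<in> chart_image c"
  then show "(local_rep c (\<lambda>x. u x * v x) has_derivative (\<lambda>e.
      local_rep c u y * frechet_derivative (local_rep c v) (at y) e
      + frechet_derivative (local_rep c u) (at y) e * local_rep c v y)) (at y)"
    using has_derivative_mult[OF C1_has_derivative[OF assms(1)] C1_has_derivative[OF assms(2)]]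
    by (simp add: local_rep_def o_def)
next
  fix c e assume "c \<in> A"
  then show "continuous_on (chart_image c) (\<lambda>y.
      local_rep c u y * frechet_derivative (local_rep c v) (at y) e
      + frechet_derivative (local_rep c u) (at y) e * local_rep c v y)"
    by (intro continuous_intros C1_continuous_derivative C1_continuous_local_rep assms)
qed

lemma X_grad_mult:
  assumes "C1 u" "C1 v"
  shows "X_grad A X (\<lambda>x. u x * v x) x = u x *\<^sub>R X_grad A X v x + v x *\<^sub>R X_grad A X u x"
proof -
  obtain c where c: "c \<in> A" "x \<in> fst c" by (rule chart_exists)
  then have y: "snd c x \<in> chart_image c" by (simp add: snd_in_chart_image)
  have "(local_rep c (\<lambda>x. u x * v x) has_derivative (\<lambda>e.
      local_rep c u (snd c x) * frechet_derivative (local_rep c v) (at (snd c x)) e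
      + frechet_derivative (local_rep c u) (at (snd c x)) e * local_rep c v (snd c x))) (at (snd c x))"
    using has_derivative_mult[OF C1_has_derivative[OF assms(1) c(1) y] C1_has_derivative[OF assms(2) c(1) y]]
    by (simp add: local_rep_def o_def)
  from vf_apply_eqI[OF C1_mult[OF assms] c this] show ?thesis
    using assms c by (simp add: X_grad_def vec_eq_iff vf_apply_in_chart local_rep_chart)
qed

lemma
  fixes H H' :: "real \<Rightarrow> real"
  assumes u: "C1 u" and H: "\<And>t. (H has_real_derivative H' t) (at t)"
    and H': "continuous_on UNIV H'"
  shows C1_compose: "C1 (\<lambda>x. H (u x))"
    and X_grad_compose: "X_grad A X (\<lambda>x. H (u x)) x = H' (u x) *\<^sub>R X_grad A X u x"
proof -
  have *: "(local_rep c (\<lambda>x. H (u x)) has_derivative (\<lambda>e.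
      H' (local_rep c u y) * frechet_derivative (local_rep c u) (at y) e)) (at y)"
    if "c \<in> A" "y \<in> chart_image c" for c y
  proof -
    have "(H has_derivative (*) (H' (local_rep c u y))) (at (local_rep c u y))"
      using H unfolding has_field_derivative_def .
    from diff_chain_at[OF C1_has_derivative[OF u that] this] show ?thesis
      by (simp add: local_rep_def o_def)
  qed
  show C1: "C1 (\<lambda>x. H (u x))"
  proof (rule C1_I[OF *])
    fix c e assume c: "c \<in> A"
    have "continuous_on (chart_image c) (\<lambda>y. H' (local_rep c u y))"
      using continuous_on_compose2[OF H' C1_continuous_local_rep[OF u c]] by simp
    then show "continuous_on (chart_image c)
        (\<lambda>y. H' (local_rep c u y) * frechet_derivative (local_rep c u) (at y) e)"
      by (intro continuous_intros C1_continuous_derivative u c)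
  qed
  obtain c where c: "c \<in> A" "x \<in> fst c" by (rule chart_exists)
  from vf_apply_eqI[OF C1 c *[OF c(1) snd_in_chart_image[OF c(2)]]]
  show "X_grad A X (\<lambda>x. H (u x)) x = H' (u x) *\<^sub>R X_grad A X u x"
    using u c by (simp add: X_grad_def vec_eq_iff vf_apply_in_chart local_rep_chart)
qed

lemma C0k_1_iff:
  "u \<in> C0k A 1 \<Omega> \<longleftrightarrow>
    C1 u \<and> compact (closure {x. u x \<noteq> 0}) \<and> closure {x. u x \<noteq> 0} \<subseteq> \<Omega>"
  by (simp add: C0k_def C1_def)

text \<open>Off the closed support a whole neighbourhood lies in the zero set, so the local
  representative is locally constant there. Hence gradients inherit compact support.\<close>

lemma X_grad_support:
  assumes "C1 u" "x \<notin> closure {x. u x \<noteq> 0}"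
  shows "X_grad A X u x = 0"
proof -
  obtain c where c: "c \<in> A" "x \<in> fst c" by (rule chart_exists)
  let ?B = "fst c - closure {x. u x \<noteq> 0}"
  have B: "open (snd c ` ?B)"
    using open_chart[OF c(1)] by (intro open_chart_subset_image c) auto
  have "(local_rep c u has_derivative (\<lambda>_. 0)) (at (snd c x))"
  proof (rule has_derivative_transform_within_open[OF has_derivative_const B])
    show "snd c x \<in> snd c ` ?B" using assms c by blast
  next
    fix y assume "y \<in> snd c ` ?B"
    then obtain z where z: "z \<in> fst c" "z \<notin> closure {x. u x \<noteq> 0}" "y = snd c z" by blast
    then have "u z = 0" using closure_subset by (metis (mono_tags) mem_Collect_eq subsetD)
    then show "0 = local_rep c u y"
      unfolding z(3) local_rep_chart[OF c(1) z(1)] by (rule sym)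
  qed
  from vf_apply_eqI[OF assms(1) c this] show ?thesis
    by (simp add: X_grad_def vec_eq_iff)
qed

section \<open>The volume measure of compact sets\<close>

lemma sets_\<mu> [measurable_cong, simp]: "sets \<mu> = sets borel"
  using vol_measure unfolding volume_measure_def by blast

lemma emeasure_chart:
  assumes "c \<in> A" "B \<in> sets borel" "B \<subseteq> fst c"
  shows "emeasure \<mu> B = (\<integral>\<^sup>+ y\<in>snd c ` B. ennreal \<bar>w c y\<bar> \<partial>lborel)"
  using vol_measure assms unfolding volume_measure_def by simp

text \<open>The measure is prescribed inside single charts, so the argument is local: on a closed
  coordinate ball the continuous coefficient \<open>w c\<close> is bounded by compactness, which
  gives every point a neighbourhood of finite measure, and finitely many of these cover
  \<open>K\<close>.\<close>

lemma compact_finite_measure: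
  assumes "compact K" shows "emeasure \<mu> K < \<infinity>"
proof -
  have "\<exists>B. open B \<and> x \<in> B \<and> emeasure \<mu> B < \<infinity>" for x
  proof -
    obtain c where c: "c \<in> A" "x \<in> fst c" by (rule chart_exists)
    obtain r where r: "r > 0" "cball (snd c x) r \<subseteq> chart_image c"
      using open_chart_image[OF c(1)] snd_in_chart_image[OF c(2)] open_contains_cball by blast
    let ?B = "fst c \<inter> snd c -` ball (snd c x) r"
    have B: "open ?B"
      by (rule continuous_open_preimage[OF continuous_on_chart[OF c(1)] open_chart[OF c(1)] open_ball])
    have im: "snd c ` ?B \<subseteq> cball (snd c x) r" by auto
    have "smooth_on (chart_image c) (w c)"
      using vol c(1) unfolding volume_form_def by blast
    then have "continuous_on (chart_image c) (w c)"
      unfolding smooth_on_def using Ck_on.simps(1) by blast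
    then have "compact (w c ` cball (snd c x) r)"
      by (rule compact_continuous_image[OF continuous_on_subset[OF _ r(2)] compact_cball])
    then have "bounded (w c ` cball (snd c x) r)" by (rule compact_imp_bounded)
    then obtain b where "\<forall>t\<in>w c ` cball (snd c x) r. norm t \<le> b"
      unfolding bounded_iff by (rule exE)
    then have b: "\<bar>w c y\<bar> \<le> b" if "y \<in> cball (snd c x) r" for y
      using that by (metis imageI real_norm_def)
    have "emeasure \<mu> ?B = (\<integral>\<^sup>+ y\<in>snd c ` ?B. ennreal \<bar>w c y\<bar> \<partial>lborel)"
      by (rule emeasure_chart[OF c(1) borel_open[OF B] Int_lower1])
    also have "\<dots> \<le> (\<integral>\<^sup>+ y. ennreal b * indicator (cball (snd c x) r) y \<partial>lborel)"
    proof (rule nn_integral_mono)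
      fix y
      show "ennreal \<bar>w c y\<bar> * indicator (snd c ` ?B) y
          \<le> ennreal b * indicator (cball (snd c x) r) y"
      proof (cases "y \<in> snd c ` ?B")
        case True
        then show ?thesis using im b ennreal_leI[OF b, of y] by (simp add: subsetD del: mem_cball)
      qed simp
    qed
    also have "\<dots> = ennreal b * emeasure lborel (cball (snd c x) r)"
      by (simp add: nn_integral_cmult_indicator)
    also have "\<dots> < \<infinity>"
      using emeasure_lborel_cball_finite[of "snd c x" r] by (simp add: ennreal_mult_less_top)
    finally show ?thesis using B c r(1) by auto
  qed
  then obtain B where B: "\<And>x. open (B x)" "\<And>x. x \<in> B x" "\<And>x. emeasure \<mu> (B x) < \<infinity>"
    by metis
  obtain F where F: "F \<subseteq> K" "finite F" "K \<subseteq> (\<Union>x\<in>F. B x)"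
    by (rule compactE_image[OF assms, of K B]) (use B(1,2) in auto)
  have "emeasure \<mu> K \<le> emeasure \<mu> (\<Union>x\<in>F. B x)"
    using F(3) B(1) by (intro emeasure_mono) (auto intro!: borel_open)
  also have "\<dots> \<le> (\<Sum>x\<in>F. emeasure \<mu> (B x))"
    using F(2) B(1) by (intro emeasure_subadditive_finite) (auto intro!: borel_open)
  also have "\<dots> < \<infinity>"
    using F(2) B(3) by simp
  finally show ?thesis .
qed

end

section \<open>Test functions\<close>

text \<open>Replacing each summand by the largest one uses no convexity, so exponents below 1 are
  covered; these occur when the lemma is applied with \<open>q\<close>.\<close>

lemma powr_add3_le:
  fixes a b c p :: real
  assumes "0 \<le> a" "0 \<le> b" "0 \<le> c" "0 < p"
  shows "(a + b + c) powr p \<le> 3 powr p * (a powr p + b powr p + c powr p)"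
proof -
  define m where "m = max a (max b c)"
  have m: "0 \<le> m" "a + b + c \<le> 3 * m" "m = a \<or> m = b \<or> m = c"
    using assms by (auto simp: m_def)
  have "(a + b + c) powr p \<le> (3 * m) powr p"
    using assms m by (intro powr_mono2) auto
  also have "\<dots> = 3 powr p * m powr p"
    using m by (simp add: powr_mult)
  also have "m powr p \<le> a powr p + b powr p + c powr p"
    using m(3) by auto
  finally show ?thesis by (simp add: mult_left_mono)
qed

text \<open>Local \<open>L^1\<close> convergence is all that the completion offers for the functions
  themselves; pointwise convergence is what continuity of \<open>H\<close> and \<open>H'\<close> can
  exploit.\<close>

lemma AE_subseq_of_L1_tendsto:
  fixes f :: "nat \<Rightarrow> 'a \<Rightarrow> real"
  assumes [measurable]: "K \<in> sets M" "\<And>i. f i \<in> borel_measurable M"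
      "set_borel_measurable M K u"
    and lim: "(\<lambda>i. \<integral>\<^sup>+ x\<in>K. ennreal \<bar>f i x - u x\<bar> \<partial>M) \<longlonglongrightarrow> 0"
  obtains r :: "nat \<Rightarrow> nat" where "strict_mono r"
    "AE x in M. x \<in> K \<longrightarrow> (\<lambda>n. f (r n) x) \<longlonglongrightarrow> u x"
proof -
  have u [measurable]: "(\<lambda>x. indicator K x * u x) \<in> borel_measurable M"
    using assms(3) by (simp add: set_borel_measurable_def)
  let ?I = "\<lambda>i. \<integral>\<^sup>+ x\<in>K. ennreal \<bar>f i x - u x\<bar> \<partial>M"
  \<comment> \<open>Finitely many of the extended integrals may be infinite. Starting at
    \<open>m\<close> makes all differences integrable.\<close>
  have "eventually (\<lambda>i. ?I i < 1) sequentially"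
    using order_tendstoD(2)[OF lim, of 1] by simp
  then obtain m where m: "\<And>i. i \<ge> m \<Longrightarrow> ?I i < 1"
    unfolding eventually_sequentially by blast
  let ?d = "\<lambda>n x. indicator K x * f (n + m) x - indicator K x * u x"
  have norm_d: "(\<integral>\<^sup>+ x. ennreal (norm (?d n x)) \<partial>M) = ?I (n + m)" for n
    by (intro nn_integral_cong) (auto simp: indicator_def)
  have int: "integrable M (?d n)" for n
  proof (rule integrableI_bounded)
    have "?I (n + m) < 1" by (rule m) simp
    also have "(1::ennreal) < \<infinity>" by simp
    finally show "(\<integral>\<^sup>+ x. ennreal (norm (?d n x)) \<partial>M) < \<infinity>"
      unfolding norm_d .
  qed measurable
  have "(\<integral>x. norm (?d n x) \<partial>M) = enn2real (?I (n + m))" for n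
    unfolding norm_d[symmetric] by (intro integral_eq_nn_integral) auto
  moreover have "(\<lambda>n. enn2real (?I (n + m))) \<longlonglongrightarrow> 0"
    using tendsto_enn2real[OF LIMSEQ_ignore_initial_segment[OF lim, of m, folded ennreal_0]] by simp
  ultimately have "(\<lambda>n. (\<integral>x. norm (?d n x) \<partial>M)) \<longlonglongrightarrow> 0" by simp
  from tendsto_L1_AE_subseq[OF int this] obtain r :: "nat \<Rightarrow> nat" where
    r: "strict_mono r" "AE x in M. (\<lambda>n. ?d (r n) x) \<longlonglongrightarrow> 0" by blast
  show thesis
  proof
    show "strict_mono (\<lambda>n. r n + m)" using r(1) by (simp add: strict_mono_def)
    show "AE x in M. x \<in> K \<longrightarrow> (\<lambda>n. f (r n + m) x) \<longlonglongrightarrow> u x"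
      using r(2) by eventually_elim (auto simp: LIM_zero_iff)
  qed
qed

lemma abs_diff_le_of_derivative_bound:
  fixes H H' :: "real \<Rightarrow> real"
  assumes "\<And>t. (H has_real_derivative H' t) (at t)" "\<And>t. \<bar>H' t\<bar> \<le> B"
  shows "\<bar>H s - H t\<bar> \<le> B * \<bar>s - t\<bar>"
  using field_differentiable_bound[of UNIV H H' B s t] assms by simp

context vector_field_family
begin

section \<open>Boundedness and integrability of functions with compact support\<close>

lemma measurable_continuous: "continuous_on UNIV F \<Longrightarrow> F \<in> borel_measurable \<mu>"
  using borel_measurable_continuous_onI measurable_cong_sets[OF sets_\<mu> refl] by blast

lemma C1_measurable: "C1 u \<Longrightarrow> u \<in> borel_measurable \<mu>"
  by (intro measurable_continuous C1_continuous)

lemma X_grad_measurable: "C1 u \<Longrightarrow> X_grad A X u \<in> borel_measurable \<mu>"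
  by (intro measurable_continuous X_grad_continuous)

lemma C0k_C1: "u \<in> C0k A 1 \<Omega> \<Longrightarrow> C1 u"
  using C0k_1_iff by blast

lemma bounded_on_compact:
  fixes F :: "'m \<Rightarrow> 'b::real_normed_vector"
  assumes "continuous_on UNIV F" "compact K"
  obtains B where "B \<ge> 0" "\<And>x. x \<in> K \<Longrightarrow> norm (F x) \<le> B"
proof -
  have "compact (F ` K)"
    using assms by (meson compact_continuous_image continuous_on_subset subset_UNIV)
  then obtain B where "B > 0" "\<forall>t\<in>F ` K. norm t \<le> B"
    using compact_imp_bounded bounded_pos by metis
  then show thesis using that[of B] by simp
qed

lemma C0k_bounded:
  assumes "u \<in> C0k A 1 \<Omega>"
  obtains B where "B \<ge> 0" "\<And>x. \<bar>u x\<bar> \<le> B"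
proof -
  let ?K = "closure {x. u x \<noteq> 0}"
  obtain B where B: "B \<ge> 0" "\<And>x. x \<in> ?K \<Longrightarrow> norm (u x) \<le> B"
    using assms bounded_on_compact[of u ?K] C1_continuous C0k_1_iff by metis
  have "\<bar>u x\<bar> \<le> B" for x
  proof (cases "u x = 0")
    case False
    then have "x \<in> ?K" using closure_subset[of "{x. u x \<noteq> 0}"] by (simp add: subsetD)
    then show ?thesis using B(2)[of x] by simp
  qed (use B in simp)
  then show thesis using that B(1) by simp
qed

lemma C0k_grad_Lp:
  assumes "u \<in> C0k A 1 \<Omega>" "0 < p"
  shows "(\<integral>\<^sup>+ x. ennreal (norm (X_grad A X u x) powr p) \<partial>\<mu>) < \<infinity>"
proof -
  let ?K = "closure {x. u x \<noteq> 0}"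
  have u: "C1 u" "compact ?K" using assms(1) C0k_1_iff by blast+
  obtain B where B: "B \<ge> 0" "\<And>x. x \<in> ?K \<Longrightarrow> norm (X_grad A X u x) \<le> B"
    using bounded_on_compact[OF X_grad_continuous[OF u(1)] u(2)] by metis
  have "(\<integral>\<^sup>+ x. ennreal (norm (X_grad A X u x) powr p) \<partial>\<mu>)
      \<le> (\<integral>\<^sup>+ x. ennreal (B powr p) * indicator ?K x \<partial>\<mu>)"
  proof (rule nn_integral_mono)
    fix x
    show "ennreal (norm (X_grad A X u x) powr p) \<le> ennreal (B powr p) * indicator ?K x"
    proof (cases "x \<in> ?K")
      case True
      then show ?thesis using B assms(2) by (simp add: ennreal_leI powr_mono2)
    next
      case False
      then show ?thesis using X_grad_support[OF u(1) False] by simp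
    qed
  qed
  also have "\<dots> = ennreal (B powr p) * emeasure \<mu> ?K"
    by (intro nn_integral_cmult_indicator) (simp add: borel_closed)
  also have "\<dots> < \<infinity>"
    using compact_finite_measure[OF u(2)] by (simp add: ennreal_mult_less_top)
  finally show ?thesis .
qed

text \<open>A triangle inequality for the \<open>p\<close>-th power of the \<open>L^p\<close> norm,
  with three terms to match the three errors of the product rule below; shorter sums are filled up
  with 0.\<close>

lemma nn_integral_powr_add3:
  fixes a b c :: "'m \<Rightarrow> real"
  assumes p: "0 < p"
    and [measurable]: "a \<in> borel_measurable \<mu>" "b \<in> borel_measurable \<mu>" "c \<in> borel_measurable \<mu>"
    and nonneg: "\<And>x. 0 \<le> a x" "\<And>x. 0 \<le> b x" "\<And>x. 0 \<le> c x"
    and le: "\<And>x. x \<in> \<Omega> \<Longrightarrow> norm (F x) \<le> a x + b x + c x"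
    and [measurable]: "\<Omega> \<in> sets \<mu>"
  shows "(\<integral>\<^sup>+ x\<in>\<Omega>. ennreal (norm (F x) powr p) \<partial>\<mu>) \<le> ennreal (3 powr p) *
    ((\<integral>\<^sup>+ x\<in>\<Omega>. ennreal (a x powr p) \<partial>\<mu>) + (\<integral>\<^sup>+ x\<in>\<Omega>. ennreal (b x powr p) \<partial>\<mu>)
      + (\<integral>\<^sup>+ x\<in>\<Omega>. ennreal (c x powr p) \<partial>\<mu>))"
proof -
  have "(\<integral>\<^sup>+ x\<in>\<Omega>. ennreal (norm (F x) powr p) \<partial>\<mu>) \<le> (\<integral>\<^sup>+ x. ennreal (3 powr p) *
    (ennreal (a x powr p) * indicator \<Omega> x + ennreal (b x powr p) * indicator \<Omega> x
      + ennreal (c x powr p) * indicator \<Omega> x) \<partial>\<mu>)"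
  proof (rule nn_integral_mono)
    fix x
    show "ennreal (norm (F x) powr p) * indicator \<Omega> x \<le> ennreal (3 powr p) *
      (ennreal (a x powr p) * indicator \<Omega> x + ennreal (b x powr p) * indicator \<Omega> x
      + ennreal (c x powr p) * indicator \<Omega> x)"
    proof (cases "x \<in> \<Omega>")
      case True
      have "norm (F x) powr p \<le> (a x + b x + c x) powr p"
        using le[OF True] p by (intro powr_mono2) auto
      also have "\<dots> \<le> 3 powr p * (a x powr p + b x powr p + c x powr p)"
        using p nonneg by (intro powr_add3_le) auto
      finally show ?thesis
        using True by (simp add: ennreal_leI flip: ennreal_mult ennreal_plus)
    qed simp
  qed
  then show ?thesis by (simp add: nn_integral_cmult nn_integral_add)
qed

section \<open>Limit gradients in the completion\<close>

lemma has_X_grad_measurable: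
  assumes "has_X_grad A \<mu> X \<Omega> p v g"
  shows "(\<lambda>x. indicator \<Omega> x *\<^sub>R g x) \<in> borel_measurable \<mu>"
    and "(\<lambda>x. indicator \<Omega> x * v x) \<in> borel_measurable \<mu>"
  using assms by (auto simp: has_X_grad_def S0_approx_def set_borel_measurable_def)

text \<open>A single approximant suffices: its gradient is bounded with compact support, and
  \<open>g\<close> differs from it by a function of finite \<open>L^p\<close> norm.\<close>

lemma has_X_grad_Lp:
  assumes g: "has_X_grad A \<mu> X \<Omega> p v g" and \<Omega>: "open \<Omega>" and p: "0 < p"
  shows "(\<integral>\<^sup>+ x\<in>\<Omega>. ennreal (norm (g x) powr p) \<partial>\<mu>) < \<infinity>"
proof -
  obtain f where f: "\<And>i. f i \<in> C0k A 1 \<Omega>"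
    and lim: "(\<lambda>i. \<integral>\<^sup>+ x\<in>\<Omega>. ennreal (norm (X_grad A X (f i) x - g x) powr p) \<partial>\<mu>) \<longlonglongrightarrow> 0"
    using g unfolding has_X_grad_def S0_approx_def by blast
  have "eventually (\<lambda>i. (\<integral>\<^sup>+ x\<in>\<Omega>. ennreal (norm (X_grad A X (f i) x - g x) powr p) \<partial>\<mu>) < 1) sequentially"
    using order_tendstoD(2)[OF lim, of 1] by simp
  then obtain i where i: "(\<integral>\<^sup>+ x\<in>\<Omega>. ennreal (norm (X_grad A X (f i) x - g x) powr p) \<partial>\<mu>) < 1"
    unfolding eventually_sequentially by blast
  \<comment> \<open>\<open>g\<close> is measurable only after restriction to
    \<open>\<Omega>\<close>; the cut-off version is measurable on the whole manifold and has the
    same integrals over \<open>\<Omega>\<close>. The functions \<open>G\<close> and \<open>V\<close>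
    in later proofs serve the same purpose.\<close>
  define G where "G x = indicator \<Omega> x *\<^sub>R g x" for x
  have [measurable]: "G \<in> borel_measurable \<mu>"
    using has_X_grad_measurable(1)[OF g] unfolding G_def .
  have [measurable]: "X_grad A X (f i) \<in> borel_measurable \<mu>"
    by (rule X_grad_measurable[OF C0k_C1[OF f]])
  have [measurable]: "\<Omega> \<in> sets \<mu>" using \<Omega> by simp
  have "(\<integral>\<^sup>+ x\<in>\<Omega>. ennreal (norm (g x) powr p) \<partial>\<mu>) \<le> ennreal (3 powr p) *
    ((\<integral>\<^sup>+ x\<in>\<Omega>. ennreal (norm (X_grad A X (f i) x) powr p) \<partial>\<mu>)
      + (\<integral>\<^sup>+ x\<in>\<Omega>. ennreal (norm (X_grad A X (f i) x - G x) powr p) \<partial>\<mu>)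
      + (\<integral>\<^sup>+ x\<in>\<Omega>. ennreal (0 powr p) \<partial>\<mu>))"
  proof (rule nn_integral_powr_add3[OF p])
    show "norm (g x) \<le> norm (X_grad A X (f i) x) + norm (X_grad A X (f i) x - G x) + 0"
      if "x \<in> \<Omega>" for x
      using that norm_triangle_sub[of "g x" "X_grad A X (f i) x"]
      by (simp add: G_def norm_minus_commute)
  qed (use \<Omega> in auto)
  also have "\<dots> < \<infinity>"
  proof -
    have "(\<integral>\<^sup>+ x\<in>\<Omega>. ennreal (norm (X_grad A X (f i) x - G x) powr p) \<partial>\<mu>)
        = (\<integral>\<^sup>+ x\<in>\<Omega>. ennreal (norm (X_grad A X (f i) x - g x) powr p) \<partial>\<mu>)"
      by (intro nn_integral_cong) (auto simp: G_def indicator_def)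
    with i have "(\<integral>\<^sup>+ x\<in>\<Omega>. ennreal (norm (X_grad A X (f i) x - G x) powr p) \<partial>\<mu>) < \<infinity>"
      using less_trans[OF _ ennreal_one_less_top] by simp
    moreover have "(\<integral>\<^sup>+ x\<in>\<Omega>. ennreal (norm (X_grad A X (f i) x) powr p) \<partial>\<mu>)
        \<le> (\<integral>\<^sup>+ x. ennreal (norm (X_grad A X (f i) x) powr p) \<partial>\<mu>)"
      by (intro nn_integral_mono) (auto simp: indicator_def)
    then have "(\<integral>\<^sup>+ x\<in>\<Omega>. ennreal (norm (X_grad A X (f i) x) powr p) \<partial>\<mu>) < \<infinity>"
      using C0k_grad_Lp[OF f p, of i] by (rule le_less_trans)
    ultimately show ?thesis by (simp add: ennreal_mult_less_top)
  qed
  finally show ?thesis .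
qed

text \<open>Supplies the Cauchy clause of \<open>S0_approx\<close> for sequences whose gradients are
  already known to converge in \<open>L^p\<close>.\<close>

lemma Cauchy_of_grad_tendsto:
  assumes \<theta>: "\<And>i. \<theta> i \<in> C0k A 1 \<Omega>" and h [measurable]: "h \<in> borel_measurable \<mu>"
    and \<Omega>: "open \<Omega>" and p: "0 < p"
    and lim: "(\<lambda>i. \<integral>\<^sup>+ x\<in>\<Omega>. ennreal (norm (X_grad A X (\<theta> i) x - h x) powr p) \<partial>\<mu>) \<longlonglongrightarrow> 0"
    and \<epsilon>: "0 < \<epsilon>"
  shows "\<exists>m. \<forall>i\<ge>m. \<forall>j\<ge>m. J_norm A \<mu> X \<Omega> p (\<lambda>x. \<theta> i x - \<theta> j x) < \<epsilon>"
proof -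
  have [measurable]: "X_grad A X (\<theta> i) \<in> borel_measurable \<mu>" for i
    by (rule X_grad_measurable[OF C0k_C1[OF \<theta>]])
  have [measurable]: "\<Omega> \<in> sets \<mu>" using \<Omega> by simp
  define I where "I i = (\<integral>\<^sup>+ x\<in>\<Omega>. ennreal (norm (X_grad A X (\<theta> i) x - h x) powr p) \<partial>\<mu>)" for i
  \<comment> \<open>Two errors below \<open>\<delta>\<close> and the factor \<open>3 powr p\<close>
    give \<open>2 / 3 * \<epsilon> powr p\<close>, which leaves a strict inequality.\<close>
  define \<delta> where "\<delta> = \<epsilon> powr p / (3 * 3 powr p)"
  have \<delta>: "0 < \<delta>" using \<epsilon> by (simp add: \<delta>_def)
  have "eventually (\<lambda>i. I i < ennreal \<delta>) sequentially"
    using order_tendstoD(2)[OF lim, of "ennreal \<delta>"] \<delta> by (simp add: I_def)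
  then obtain m where m: "\<And>i. i \<ge> m \<Longrightarrow> I i < ennreal \<delta>"
    unfolding eventually_sequentially by blast
  have "J_norm A \<mu> X \<Omega> p (\<lambda>x. \<theta> i x - \<theta> j x) < \<epsilon>" if ij: "i \<ge> m" "j \<ge> m" for i j
  proof -
    define F where "F x = X_grad A X (\<theta> i) x - X_grad A X (\<theta> j) x" for x
    have [measurable]: "F \<in> borel_measurable \<mu>" unfolding F_def by measurable
    have F: "X_grad A X (\<lambda>x. \<theta> i x - \<theta> j x) = F"
      using X_grad_diff[OF C0k_C1[OF \<theta>] C0k_C1[OF \<theta>]] by (simp add: F_def fun_eq_iff)
    define L where "L = (LINT x:\<Omega>|\<mu>. norm (F x) powr p)"
    \<comment> \<open>The norm is defined by the Lebesgue integral, whose default value 0 for a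
      divergent integral agrees with \<open>enn2real\<close> of \<open>\<infinity>\<close>; the
      estimate can therefore be made with extended integrals.\<close>
    have "L = enn2real (\<integral>\<^sup>+ x. ennreal (indicator \<Omega> x *\<^sub>R norm (F x) powr p) \<partial>\<mu>)"
      unfolding L_def set_lebesgue_integral_def by (intro integral_eq_nn_integral) auto
    also have "(\<integral>\<^sup>+ x. ennreal (indicator \<Omega> x *\<^sub>R norm (F x) powr p) \<partial>\<mu>)
        = (\<integral>\<^sup>+ x\<in>\<Omega>. ennreal (norm (F x) powr p) \<partial>\<mu>)"
      by (intro nn_integral_cong) (auto simp: indicator_def)
    finally have L: "L = enn2real (\<integral>\<^sup>+ x\<in>\<Omega>. ennreal (norm (F x) powr p) \<partial>\<mu>)" .
    have "(\<integral>\<^sup>+ x\<in>\<Omega>. ennreal (norm (F x) powr p) \<partial>\<mu>)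
        \<le> ennreal (3 powr p) * (I i + I j + (\<integral>\<^sup>+ x\<in>\<Omega>. ennreal (0 powr p) \<partial>\<mu>))"
      unfolding I_def
    proof (rule nn_integral_powr_add3[OF p])
      show "norm (F x) \<le> norm (X_grad A X (\<theta> i) x - h x) + norm (X_grad A X (\<theta> j) x - h x) + 0" for x
        using norm_triangle_ineq4[of "X_grad A X (\<theta> i) x - h x" "X_grad A X (\<theta> j) x - h x"]
        by (simp add: F_def)
    qed (use \<Omega> in auto)
    also have "\<dots> \<le> ennreal (3 powr p) * (ennreal \<delta> + ennreal \<delta>)"
      using m[OF ij(1)] m[OF ij(2)] by (intro mult_left_mono) (auto intro!: add_mono)
    also have "\<dots> = ennreal (2 / 3 * \<epsilon> powr p)"
      using \<delta> by (simp add: \<delta>_def flip: ennreal_plus ennreal_mult)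
    finally have "L \<le> 2 / 3 * \<epsilon> powr p"
      unfolding L by (intro enn2real_leI) auto
    moreover have "0 < \<epsilon> powr p" using \<epsilon> by simp
    ultimately have "L < \<epsilon> powr p" by linarith
    moreover have "0 \<le> L" unfolding L by simp
    ultimately have "L powr (1 / p) < (\<epsilon> powr p) powr (1 / p)"
      using p by (intro powr_less_mono2) auto
    then show ?thesis
      using p \<epsilon> by (simp add: J_norm_def F L_def powr_powr)
  qed
  then show ?thesis by blast
qed

lemma nn_integral_powr_tendsto_0:
  fixes F :: "nat \<Rightarrow> 'm \<Rightarrow> real"
  assumes p: "0 < p" and [measurable]: "\<And>n. F n \<in> borel_measurable \<mu>" "D \<in> borel_measurable \<mu>"
      "\<Omega> \<in> sets \<mu>"
    and bound: "\<And>n x. 0 \<le> F n x" "\<And>n x. x \<in> \<Omega> \<Longrightarrow> F n x \<le> C * D x" "0 \<le> C" "\<And>x. 0 \<le> D x"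
    and fin: "(\<integral>\<^sup>+ x\<in>\<Omega>. ennreal (D x powr p) \<partial>\<mu>) < \<infinity>"
    and lim: "AE x in \<mu>. x \<in> \<Omega> \<longrightarrow> (\<lambda>n. F n x) \<longlonglongrightarrow> 0"
  shows "(\<lambda>n. \<integral>\<^sup>+ x\<in>\<Omega>. ennreal (F n x powr p) \<partial>\<mu>) \<longlonglongrightarrow> 0"
proof -
  have "(\<lambda>n. \<integral>\<^sup>+ x\<in>\<Omega>. ennreal (F n x powr p) \<partial>\<mu>) \<longlonglongrightarrow> (\<integral>\<^sup>+ x. 0 \<partial>\<mu>)"
  proof (rule nn_integral_dominated_convergence)
    show "AE x in \<mu>. ennreal (F n x powr p) * indicator \<Omega> x
        \<le> ennreal (C powr p) * (ennreal (D x powr p) * indicator \<Omega> x)" for n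
    proof (rule AE_I2)
      fix x
      have "F n x powr p \<le> C powr p * D x powr p" if "x \<in> \<Omega>"
        using powr_mono2[OF less_imp_le[OF p] bound(1) bound(2)[OF that]] bound(3,4)
        by (simp add: powr_mult)
      then show "ennreal (F n x powr p) * indicator \<Omega> x
          \<le> ennreal (C powr p) * (ennreal (D x powr p) * indicator \<Omega> x)"
        by (auto simp: indicator_def ennreal_leI simp flip: ennreal_mult)
    qed
    show "(\<integral>\<^sup>+ x. ennreal (C powr p) * (ennreal (D x powr p) * indicator \<Omega> x) \<partial>\<mu>) < \<infinity>"
      using fin by (simp add: nn_integral_cmult ennreal_mult_less_top)
    show "AE x in \<mu>. (\<lambda>n. ennreal (F n x powr p) * indicator \<Omega> x) \<longlonglongrightarrow> 0"
      using lim
    proof eventually_elim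
      case (elim x)
      show ?case
      proof (cases "x \<in> \<Omega>")
        case True
        with elim have "(\<lambda>n. F n x) \<longlonglongrightarrow> 0" by simp
        then have "(\<lambda>n. F n x powr p) \<longlonglongrightarrow> 0"
          using p bound(1) by (intro tendsto_zero_powrI[where b = p]) auto
        then have "(\<lambda>n. ennreal (F n x powr p)) \<longlonglongrightarrow> ennreal 0" by (rule tendsto_ennrealI)
        then show ?thesis using True by simp
      qed simp
    qed
  qed measurable
  then show ?thesis by simp
qed

text \<open>This makes the test function admissible. The approximants are
  \<open>\<psi> * H (f i)\<close>: the factor \<open>\<psi>\<close> restores compact support and
  restricts pointwise convergence to the compact set \<open>K\<close>, and the bounds on
  \<open>H\<close> and \<open>H'\<close> give majorants although \<open>v\<close> is only locally
  integrable. Passing to a subsequence is harmless, since it preserves both modes of convergence and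
  the definition asks only for some approximating sequence.\<close>

lemma has_X_grad_mult_compose:
  fixes H H' :: "real \<Rightarrow> real"
  assumes v: "has_X_grad A \<mu> X \<Omega> p v g" and \<Omega>: "open \<Omega>" and p: "0 < p"
    and \<psi>: "\<psi> \<in> C0k A 1 \<Omega>"
    and H: "\<And>t. (H has_real_derivative H' t) (at t)" and H': "continuous_on UNIV H'"
    and B: "\<And>t. \<bar>H t\<bar> \<le> B" "\<And>t. \<bar>H' t\<bar> \<le> B"
  shows "has_X_grad A \<mu> X \<Omega> p (\<lambda>x. \<psi> x * H (v x))
    (\<lambda>x. H (v x) *\<^sub>R X_grad A X \<psi> x + (\<psi> x * H' (v x)) *\<^sub>R g x)"
proof -
  obtain f where S0: "S0_approx A \<mu> X \<Omega> p f v"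
    and lim: "(\<lambda>i. \<integral>\<^sup>+ x\<in>\<Omega>. ennreal (norm (X_grad A X (f i) x - g x) powr p) \<partial>\<mu>) \<longlonglongrightarrow> 0"
    using v unfolding has_X_grad_def by blast
  have f: "f i \<in> C0k A 1 \<Omega>" for i
    using S0 unfolding S0_approx_def by blast
  have L1: "(\<lambda>i. \<integral>\<^sup>+ x\<in>K. ennreal \<bar>f i x - v x\<bar> \<partial>\<mu>) \<longlonglongrightarrow> 0"
    if "compact K" "K \<subseteq> \<Omega>" for K
    using S0 that unfolding S0_approx_def by simp
  define K where "K = closure {x. \<psi> x \<noteq> 0}"
  have \<psi>C1: "C1 \<psi>" and K: "compact K" "K \<subseteq> \<Omega>"
    using \<psi> C0k_1_iff unfolding K_def by blast+
  have off_K: "\<psi> x = 0" "X_grad A X \<psi> x = 0" if "x \<notin> K" for x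
  proof -
    show "X_grad A X \<psi> x = 0" using that unfolding K_def by (rule X_grad_support[OF \<psi>C1])
    have "x \<notin> {x. \<psi> x \<noteq> 0}"
      using that subsetD[OF closure_subset, of x "{x. \<psi> x \<noteq> 0}"] unfolding K_def by (rule contrapos_nn)
    then show "\<psi> x = 0" by simp
  qed
  have [measurable]: "\<Omega> \<in> sets \<mu>" "K \<in> sets \<mu>"
    using \<Omega> K(1) by (auto intro: borel_closed compact_imp_closed)
  define G where "G x = indicator \<Omega> x *\<^sub>R g x" for x
  define V where "V x = indicator \<Omega> x * v x" for x
  have G [measurable]: "G \<in> borel_measurable \<mu>" and V [measurable]: "V \<in> borel_measurable \<mu>"
    using has_X_grad_measurable[OF v] unfolding G_def V_def .
  have G_eq: "G x = g x" and V_eq: "V x = v x" if "x \<in> \<Omega>" for x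
    using that by (auto simp: G_def V_def)
  have fm [measurable]: "f i \<in> borel_measurable \<mu>" "X_grad A X (f i) \<in> borel_measurable \<mu>" for i
    using C1_measurable X_grad_measurable C0k_C1[OF f] by blast+
  have [measurable]: "\<psi> \<in> borel_measurable \<mu>" "X_grad A X \<psi> \<in> borel_measurable \<mu>"
    using C1_measurable X_grad_measurable \<psi>C1 by blast+
  have Hcont: "continuous_on UNIV H"
    using H by (meson DERIV_isCont continuous_at_imp_continuous_on)
  have [measurable]: "H \<in> borel_measurable borel" "H' \<in> borel_measurable borel"
    using Hcont H' by (auto intro: borel_measurable_continuous_onI)
  obtain P where P: "P \<ge> 0" "\<And>x. \<bar>\<psi> x\<bar> \<le> P" using C0k_bounded[OF \<psi>] by blast
  have B0: "0 \<le> B" using B(1)[of 0] by linarith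

  obtain r where r: "strict_mono r" "AE x in \<mu>. x \<in> K \<longrightarrow> (\<lambda>n. f (r n) x) \<longlonglongrightarrow> V x"
  proof (rule AE_subseq_of_L1_tendsto[of K \<mu> f V])
    show "set_borel_measurable \<mu> K V" unfolding set_borel_measurable_def by measurable
    have "(\<integral>\<^sup>+ x\<in>K. ennreal \<bar>f i x - V x\<bar> \<partial>\<mu>) = (\<integral>\<^sup>+ x\<in>K. ennreal \<bar>f i x - v x\<bar> \<partial>\<mu>)" for i
      using K(2) V_eq by (intro nn_integral_cong) (auto simp: indicator_def)
    then show "(\<lambda>i. \<integral>\<^sup>+ x\<in>K. ennreal \<bar>f i x - V x\<bar> \<partial>\<mu>) \<longlonglongrightarrow> 0"
      using L1[OF K] by simp
  qed (use fm K(1) in \<open>auto intro: borel_closed compact_imp_closed\<close>)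
  define k where "k n = f (r n)" for n
  have k: "k n \<in> C0k A 1 \<Omega>" and km [measurable]: "k n \<in> borel_measurable \<mu>"
      "X_grad A X (k n) \<in> borel_measurable \<mu>" for n
    unfolding k_def by (rule f fm)+
  have k_AE: "AE x in \<mu>. x \<in> K \<longrightarrow> (\<lambda>n. k n x) \<longlonglongrightarrow> V x" using r(2) by (simp add: k_def)
  have k_grad: "(\<lambda>n. \<integral>\<^sup>+ x\<in>\<Omega>. ennreal (norm (X_grad A X (k n) x - g x) powr p) \<partial>\<mu>) \<longlonglongrightarrow> 0"
    using LIMSEQ_subseq_LIMSEQ[OF lim r(1)] by (simp add: k_def o_def)
  have k_L1: "(\<lambda>n. \<integral>\<^sup>+ x\<in>C. ennreal \<bar>k n x - v x\<bar> \<partial>\<mu>) \<longlonglongrightarrow> 0" if "compact C" "C \<subseteq> \<Omega>" for C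
    using LIMSEQ_subseq_LIMSEQ[OF L1[OF that] r(1)] by (simp add: k_def o_def)

  define \<theta> where "\<theta> n x = \<psi> x * H (k n x)" for n x
  define h where "h x = H (v x) *\<^sub>R X_grad A X \<psi> x + (\<psi> x * H' (v x)) *\<^sub>R g x" for x
  define hm where "hm x = H (V x) *\<^sub>R X_grad A X \<psi> x + (\<psi> x * H' (V x)) *\<^sub>R G x" for x
  have h_eq: "hm x = h x" if "x \<in> \<Omega>" for x
    using that by (simp add: hm_def h_def G_eq V_eq)
  have [measurable]: "hm \<in> borel_measurable \<mu>" unfolding hm_def by measurable
  have \<theta>: "\<theta> n \<in> C0k A 1 \<Omega>" for n
  proof -
    have sub: "closure {x. \<theta> n x \<noteq> 0} \<subseteq> K"
      unfolding K_def by (rule closure_mono) (auto simp: \<theta>_def)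
    then have "compact (closure {x. \<theta> n x \<noteq> 0})"
      using K(1) by (metis closed_closure compact_Int_closed inf.absorb_iff2)
    moreover have "C1 (\<theta> n)"
      unfolding \<theta>_def by (intro C1_mult \<psi>C1 C1_compose[OF C0k_C1[OF k] H H'])
    ultimately show ?thesis using sub K(2) C0k_1_iff by blast
  qed
  have X\<theta>: "X_grad A X (\<theta> n) x
      = \<psi> x *\<^sub>R (H' (k n x) *\<^sub>R X_grad A X (k n) x) + H (k n x) *\<^sub>R X_grad A X \<psi> x" for n x
    unfolding \<theta>_def X_grad_mult[OF \<psi>C1 C1_compose[OF C0k_C1[OF k] H H']]
      X_grad_compose[OF C0k_C1[OF k] H H'] ..

  \<comment> \<open>The error of the gradient splits so that only \<open>T2\<close> contains a
    varying gradient. It needs just a bounded coefficient and the \<open>L^p\<close> convergence of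
    the gradients; \<open>T1\<close> and \<open>T3\<close> have fixed gradients and tend to 0 by
    dominated convergence.\<close>
  define T1 where "T1 n x = \<bar>H (k n x) - H (V x)\<bar> * norm (X_grad A X \<psi> x)" for n x
  define T2 where "T2 n x = \<bar>\<psi> x * H' (k n x)\<bar> * norm (X_grad A X (k n) x - G x)" for n x
  define T3 where "T3 n x = \<bar>\<psi> x * (H' (k n x) - H' (V x))\<bar> * norm (G x)" for n x
  have [measurable]: "T1 n \<in> borel_measurable \<mu>" "T2 n \<in> borel_measurable \<mu>"
    "T3 n \<in> borel_measurable \<mu>" for n
    unfolding T1_def T2_def T3_def by measurable
  have "(\<lambda>n. \<integral>\<^sup>+ x\<in>\<Omega>. ennreal (T1 n x powr p) \<partial>\<mu>) \<longlonglongrightarrow> 0"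
  proof (rule nn_integral_powr_tendsto_0[OF p, where C = "2 * B" and D = "\<lambda>x. norm (X_grad A X \<psi> x)"])
    show "T1 n x \<le> 2 * B * norm (X_grad A X \<psi> x)" for n x
      unfolding T1_def using B(1)[of "k n x"] B(1)[of "V x"] by (intro mult_right_mono) auto
    have "(\<integral>\<^sup>+ x\<in>\<Omega>. ennreal (norm (X_grad A X \<psi> x) powr p) \<partial>\<mu>)
        \<le> (\<integral>\<^sup>+ x. ennreal (norm (X_grad A X \<psi> x) powr p) \<partial>\<mu>)"
      by (intro nn_integral_mono) (auto simp: indicator_def)
    then show "(\<integral>\<^sup>+ x\<in>\<Omega>. ennreal (norm (X_grad A X \<psi> x) powr p) \<partial>\<mu>) < \<infinity>"
      using C0k_grad_Lp[OF \<psi> p] by (rule le_less_trans)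
    show "AE x in \<mu>. x \<in> \<Omega> \<longrightarrow> (\<lambda>n. T1 n x) \<longlonglongrightarrow> 0"
      using k_AE
    proof eventually_elim
      case (elim x)
      show ?case
      proof (cases "x \<in> K")
        case True
        with elim have "(\<lambda>n. H (k n x)) \<longlonglongrightarrow> H (V x)"
          using continuous_on_tendsto_compose[OF Hcont, of "\<lambda>n. k n x"] by simp
        then have "(\<lambda>n. \<bar>H (k n x) - H (V x)\<bar>) \<longlonglongrightarrow> 0"
          by (intro tendsto_rabs_zero) (simp add: LIM_zero)
        then show ?thesis unfolding T1_def using tendsto_mult_left_zero by blast
      qed (simp add: T1_def off_K)
    qed
  qed (use B0 \<Omega> in \<open>auto simp: T1_def\<close>)
  moreover have "(\<lambda>n. \<integral>\<^sup>+ x\<in>\<Omega>. ennreal (T2 n x powr p) \<partial>\<mu>) \<longlonglongrightarrow> 0"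
  proof (rule tendsto_sandwich[OF always_eventually always_eventually tendsto_const])
    show "\<forall>n. (\<integral>\<^sup>+ x\<in>\<Omega>. ennreal (T2 n x powr p) \<partial>\<mu>) \<le> ennreal ((P * B) powr p) *
        (\<integral>\<^sup>+ x\<in>\<Omega>. ennreal (norm (X_grad A X (k n) x - G x) powr p) \<partial>\<mu>)"
    proof
      fix n
      have "(\<integral>\<^sup>+ x\<in>\<Omega>. ennreal (T2 n x powr p) \<partial>\<mu>) \<le> (\<integral>\<^sup>+ x. ennreal ((P * B) powr p) *
        (ennreal (norm (X_grad A X (k n) x - G x) powr p) * indicator \<Omega> x) \<partial>\<mu>)"
      proof (rule nn_integral_mono)
        fix x
        have "T2 n x \<le> P * B * norm (X_grad A X (k n) x - G x)"
          unfolding T2_def abs_mult using P B(2)[of "k n x"]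
          by (intro mult_right_mono mult_mono) auto
        then have "T2 n x powr p \<le> (P * B * norm (X_grad A X (k n) x - G x)) powr p"
          using p by (intro powr_mono2) (auto simp: T2_def)
        also have "\<dots> = (P * B) powr p * norm (X_grad A X (k n) x - G x) powr p"
          using P B0 by (simp add: powr_mult)
        finally show "ennreal (T2 n x powr p) * indicator \<Omega> x \<le> ennreal ((P * B) powr p) *
            (ennreal (norm (X_grad A X (k n) x - G x) powr p) * indicator \<Omega> x)"
          by (auto simp: indicator_def ennreal_leI simp flip: ennreal_mult)
      qed
      then show "(\<integral>\<^sup>+ x\<in>\<Omega>. ennreal (T2 n x powr p) \<partial>\<mu>) \<le> ennreal ((P * B) powr p) *
        (\<integral>\<^sup>+ x\<in>\<Omega>. ennreal (norm (X_grad A X (k n) x - G x) powr p) \<partial>\<mu>)"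
        by (simp add: nn_integral_cmult)
    qed
    have "(\<integral>\<^sup>+ x\<in>\<Omega>. ennreal (norm (X_grad A X (k n) x - G x) powr p) \<partial>\<mu>)
        = (\<integral>\<^sup>+ x\<in>\<Omega>. ennreal (norm (X_grad A X (k n) x - g x) powr p) \<partial>\<mu>)" for n
      by (intro nn_integral_cong) (auto simp: G_eq indicator_def)
    then show "(\<lambda>n. ennreal ((P * B) powr p) *
        (\<integral>\<^sup>+ x\<in>\<Omega>. ennreal (norm (X_grad A X (k n) x - G x) powr p) \<partial>\<mu>)) \<longlonglongrightarrow> 0"
      using ennreal_tendsto_cmult[OF _ k_grad, of "ennreal ((P * B) powr p)"] by simp
  qed simp
  moreover have "(\<lambda>n. \<integral>\<^sup>+ x\<in>\<Omega>. ennreal (T3 n x powr p) \<partial>\<mu>) \<longlonglongrightarrow> 0"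
  proof (rule nn_integral_powr_tendsto_0[OF p, where C = "P * (2 * B)" and D = "\<lambda>x. norm (G x)"])
    show "T3 n x \<le> P * (2 * B) * norm (G x)" for n x
      unfolding T3_def abs_mult using P B(2)[of "k n x"] B(2)[of "V x"]
      by (intro mult_right_mono mult_mono) auto
    have "(\<integral>\<^sup>+ x\<in>\<Omega>. ennreal (norm (G x) powr p) \<partial>\<mu>) = (\<integral>\<^sup>+ x\<in>\<Omega>. ennreal (norm (g x) powr p) \<partial>\<mu>)"
      by (intro nn_integral_cong) (auto simp: G_eq indicator_def)
    then show "(\<integral>\<^sup>+ x\<in>\<Omega>. ennreal (norm (G x) powr p) \<partial>\<mu>) < \<infinity>"
      using has_X_grad_Lp[OF v \<Omega> p] by simp
    show "AE x in \<mu>. x \<in> \<Omega> \<longrightarrow> (\<lambda>n. T3 n x) \<longlonglongrightarrow> 0"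
      using k_AE
    proof eventually_elim
      case (elim x)
      show ?case
      proof (cases "x \<in> K")
        case True
        with elim have "(\<lambda>n. H' (k n x)) \<longlonglongrightarrow> H' (V x)"
          using continuous_on_tendsto_compose[OF H', of "\<lambda>n. k n x"] by simp
        then have "(\<lambda>n. \<psi> x * (H' (k n x) - H' (V x))) \<longlonglongrightarrow> 0"
          by (intro tendsto_mult_right_zero) (simp add: LIM_zero)
        then have "(\<lambda>n. \<bar>\<psi> x * (H' (k n x) - H' (V x))\<bar>) \<longlonglongrightarrow> 0"
          by (rule tendsto_rabs_zero)
        then show ?thesis unfolding T3_def using tendsto_mult_left_zero by blast
      qed (simp add: T3_def off_K)
    qed
  qed (use P B0 \<Omega> in \<open>auto simp: T3_def\<close>)
  ultimately have "(\<lambda>n. ennreal (3 powr p) * ((\<integral>\<^sup>+ x\<in>\<Omega>. ennreal (T1 n x powr p) \<partial>\<mu>)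
      + (\<integral>\<^sup>+ x\<in>\<Omega>. ennreal (T2 n x powr p) \<partial>\<mu>) + (\<integral>\<^sup>+ x\<in>\<Omega>. ennreal (T3 n x powr p) \<partial>\<mu>)))
      \<longlonglongrightarrow> ennreal (3 powr p) * (0 + 0 + 0)"
    by (intro ennreal_tendsto_cmult tendsto_add) auto
  then have T_lim: "(\<lambda>n. ennreal (3 powr p) * ((\<integral>\<^sup>+ x\<in>\<Omega>. ennreal (T1 n x powr p) \<partial>\<mu>)
      + (\<integral>\<^sup>+ x\<in>\<Omega>. ennreal (T2 n x powr p) \<partial>\<mu>) + (\<integral>\<^sup>+ x\<in>\<Omega>. ennreal (T3 n x powr p) \<partial>\<mu>)))
      \<longlonglongrightarrow> 0"
    by simp
  have \<theta>_lim: "(\<lambda>n. \<integral>\<^sup>+ x\<in>\<Omega>. ennreal (norm (X_grad A X (\<theta> n) x - hm x) powr p) \<partial>\<mu>) \<longlonglongrightarrow> 0"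
  proof (rule tendsto_sandwich[OF always_eventually always_eventually tendsto_const T_lim])
    show "\<forall>n. (\<integral>\<^sup>+ x\<in>\<Omega>. ennreal (norm (X_grad A X (\<theta> n) x - hm x) powr p) \<partial>\<mu>) \<le>
      ennreal (3 powr p) * ((\<integral>\<^sup>+ x\<in>\<Omega>. ennreal (T1 n x powr p) \<partial>\<mu>)
      + (\<integral>\<^sup>+ x\<in>\<Omega>. ennreal (T2 n x powr p) \<partial>\<mu>) + (\<integral>\<^sup>+ x\<in>\<Omega>. ennreal (T3 n x powr p) \<partial>\<mu>))"
    proof (rule allI, rule nn_integral_powr_add3[OF p])
      fix n x
      have eq: "X_grad A X (\<theta> n) x - hm x = (H (k n x) - H (V x)) *\<^sub>R X_grad A X \<psi> x
          + (\<psi> x * H' (k n x)) *\<^sub>R (X_grad A X (k n) x - G x)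
          + (\<psi> x * (H' (k n x) - H' (V x))) *\<^sub>R G x"
        unfolding X\<theta> hm_def by (simp add: algebra_simps)
      show "norm (X_grad A X (\<theta> n) x - hm x) \<le> T1 n x + T2 n x + T3 n x"
        unfolding eq T1_def T2_def T3_def norm_scaleR[symmetric]
        by (intro norm_triangle_mono order_refl)
    qed (use \<Omega> in \<open>auto simp: T1_def T2_def T3_def\<close>)
  qed simp
  have "(\<integral>\<^sup>+ x\<in>\<Omega>. ennreal (norm (X_grad A X (\<theta> n) x - hm x) powr p) \<partial>\<mu>)
      = (\<integral>\<^sup>+ x\<in>\<Omega>. ennreal (norm (X_grad A X (\<theta> n) x - h x) powr p) \<partial>\<mu>)" for n
    by (intro nn_integral_cong) (auto simp: h_eq indicator_def)
  then have "(\<lambda>n. \<integral>\<^sup>+ x\<in>\<Omega>. ennreal (norm (X_grad A X (\<theta> n) x - h x) powr p) \<partial>\<mu>) \<longlonglongrightarrow> 0"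
    using \<theta>_lim by simp
  moreover have "set_borel_measurable \<mu> \<Omega> h"
  proof -
    have "(\<lambda>x. indicator \<Omega> x *\<^sub>R h x) = (\<lambda>x. indicator \<Omega> x *\<^sub>R hm x)"
      by (auto simp: h_eq indicator_def fun_eq_iff)
    then show ?thesis unfolding set_borel_measurable_def by simp
  qed
  moreover have "S0_approx A \<mu> X \<Omega> p \<theta> (\<lambda>x. \<psi> x * H (v x))"
    unfolding S0_approx_def
  proof (intro conjI allI impI)
    show "\<theta> i \<in> C0k A 1 \<Omega>" for i by (rule \<theta>)
  next
    fix \<epsilon> :: real assume "0 < \<epsilon>"
    then show "\<exists>m. \<forall>i\<ge>m. \<forall>j\<ge>m. J_norm A \<mu> X \<Omega> p (\<lambda>x. \<theta> i x - \<theta> j x) < \<epsilon>"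
      by (intro Cauchy_of_grad_tendsto[OF \<theta> _ \<Omega> p \<theta>_lim]) measurable
  next
    have "(\<lambda>x. indicator \<Omega> x *\<^sub>R (\<psi> x * H (v x))) = (\<lambda>x. indicator \<Omega> x *\<^sub>R (\<psi> x * H (V x)))"
      by (auto simp: V_eq indicator_def fun_eq_iff)
    then show "set_borel_measurable \<mu> \<Omega> (\<lambda>x. \<psi> x * H (v x))"
      unfolding set_borel_measurable_def by simp
  next
    fix C assume C: "compact C \<and> C \<subseteq> \<Omega>"
    show "(\<lambda>i. \<integral>\<^sup>+ x\<in>C. ennreal \<bar>\<theta> i x - \<psi> x * H (v x)\<bar> \<partial>\<mu>) \<longlonglongrightarrow> 0"
    \<comment> \<open>The bound on \<open>H'\<close> makes \<open>H\<close> Lipschitz, so local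
      \<open>L^1\<close> convergence of \<open>k\<close> to \<open>v\<close> carries over.\<close>
    proof (rule tendsto_sandwich[OF always_eventually always_eventually tendsto_const])
      show "\<forall>i. (\<integral>\<^sup>+ x\<in>C. ennreal \<bar>\<theta> i x - \<psi> x * H (v x)\<bar> \<partial>\<mu>)
          \<le> ennreal (P * B) * (\<integral>\<^sup>+ x\<in>C. ennreal \<bar>k i x - V x\<bar> \<partial>\<mu>)"
      proof
        fix i
        have "(\<integral>\<^sup>+ x\<in>C. ennreal \<bar>\<theta> i x - \<psi> x * H (v x)\<bar> \<partial>\<mu>)
          \<le> (\<integral>\<^sup>+ x. ennreal (P * B) * (ennreal \<bar>k i x - V x\<bar> * indicator C x) \<partial>\<mu>)"
        proof (rule nn_integral_mono)
          fix x
          have "\<bar>\<theta> i x - \<psi> x * H (v x)\<bar> \<le> P * B * \<bar>k i x - V x\<bar>" if "x \<in> C"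
          proof -
            have "\<bar>\<theta> i x - \<psi> x * H (v x)\<bar> = \<bar>\<psi> x\<bar> * \<bar>H (k i x) - H (V x)\<bar>"
              using C V_eq[of x] that by (auto simp: \<theta>_def right_diff_distrib simp flip: abs_mult)
            also have "\<dots> \<le> P * (B * \<bar>k i x - V x\<bar>)"
              using P by (intro mult_mono abs_diff_le_of_derivative_bound[OF H B(2)]) auto
            finally show ?thesis by simp
          qed
          then show "ennreal \<bar>\<theta> i x - \<psi> x * H (v x)\<bar> * indicator C x
              \<le> ennreal (P * B) * (ennreal \<bar>k i x - V x\<bar> * indicator C x)"
            using P(1) B0 by (auto simp: indicator_def ennreal_leI simp flip: ennreal_mult)
        qed
        also have "\<dots> = ennreal (P * B) * (\<integral>\<^sup>+ x\<in>C. ennreal \<bar>k i x - V x\<bar> \<partial>\<mu>)"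
        proof (rule nn_integral_cmult)
          have [measurable]: "C \<in> sets \<mu>" using C by (auto intro: borel_closed compact_imp_closed)
          show "(\<lambda>x. ennreal \<bar>k i x - V x\<bar> * indicator C x) \<in> borel_measurable \<mu>" by measurable
        qed
        finally show "(\<integral>\<^sup>+ x\<in>C. ennreal \<bar>\<theta> i x - \<psi> x * H (v x)\<bar> \<partial>\<mu>)
          \<le> ennreal (P * B) * (\<integral>\<^sup>+ x\<in>C. ennreal \<bar>k i x - V x\<bar> \<partial>\<mu>)" .
      qed
      have "(\<integral>\<^sup>+ x\<in>C. ennreal \<bar>k i x - V x\<bar> \<partial>\<mu>) = (\<integral>\<^sup>+ x\<in>C. ennreal \<bar>k i x - v x\<bar> \<partial>\<mu>)" for i
        using C by (intro nn_integral_cong) (auto simp: V_eq indicator_def)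
      then show "(\<lambda>i. ennreal (P * B) * (\<integral>\<^sup>+ x\<in>C. ennreal \<bar>k i x - V x\<bar> \<partial>\<mu>)) \<longlonglongrightarrow> 0"
        using ennreal_tendsto_cmult[OF _ k_L1, of "ennreal (P * B)" C] C by simp
    qed simp
  qed
  ultimately show ?thesis unfolding has_X_grad_def h_def by (intro conjI exI)
qed

end

section \<open>The energy estimate and passage to the limit\<close>

text \<open>As the shift is at most 1, \<open>3 powr q * (V x powr q + 1) * \<rho> x\<close> is a
  common majorant. Its second part is integrable because \<open>\<rho>\<close> itself is, which for
  the weights used later comes from compact support.\<close>

lemma
  fixes V \<rho> :: "'a \<Rightarrow> real"
  assumes [measurable]: "V \<in> borel_measurable M" "\<rho> \<in> borel_measurable M" "\<Omega> \<in> sets M"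
    and pos: "AE x in M. x \<in> \<Omega> \<longrightarrow> 0 < V x" and \<rho>: "\<And>x. 0 \<le> \<rho> x" and q: "0 < q"
    and fin: "(\<integral>\<^sup>+ x\<in>\<Omega>. ennreal (\<rho> x) \<partial>M) < \<infinity>" "(\<integral>\<^sup>+ x\<in>\<Omega>. ennreal (V x powr q * \<rho> x) \<partial>M) < \<infinity>"
  shows shifted_powr_finite:
      "(\<integral>\<^sup>+ x\<in>\<Omega>. ennreal ((V x + inverse (real (Suc n))) powr q * \<rho> x) \<partial>M) < \<infinity>"
    and shifted_powr_tendsto: "(\<lambda>n. \<integral>\<^sup>+ x\<in>\<Omega>. ennreal ((V x + inverse (real (Suc n))) powr q * \<rho> x) \<partial>M)
      \<longlonglongrightarrow> (\<integral>\<^sup>+ x\<in>\<Omega>. ennreal (V x powr q * \<rho> x) \<partial>M)"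
proof -
  let ?u = "\<lambda>n x. ennreal ((V x + inverse (real (Suc n))) powr q * \<rho> x) * indicator \<Omega> x"
  let ?w = "\<lambda>x. ennreal (3 powr q) *
    (ennreal (V x powr q * \<rho> x) * indicator \<Omega> x + ennreal (\<rho> x) * indicator \<Omega> x)"
  have w: "(\<integral>\<^sup>+ x. ?w x \<partial>M) < \<infinity>"
    using fin by (simp add: nn_integral_cmult nn_integral_add ennreal_mult_less_top)
  have bound: "AE x in M. ?u n x \<le> ?w x" for n
    using pos
  proof eventually_elim
    case (elim x)
    show ?case
    proof (cases "x \<in> \<Omega>")
      case True
      with elim have V: "0 < V x" by simp
      let ?e = "inverse (real (Suc n))"
      have e: "0 < ?e" "?e \<le> 1" by (auto simp: inverse_le_1_iff)
      then have "?e powr q \<le> 1"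
        using powr_mono2[of q ?e 1] q by simp
      moreover have "(V x + ?e) powr q \<le> 3 powr q * (V x powr q + ?e powr q)"
        using powr_add3_le[of "V x" ?e 0 q] V e q by simp
      moreover have "3 powr q * (V x powr q + ?e powr q) \<le> 3 powr q * (V x powr q + 1)"
        using calculation(1) by (intro mult_left_mono) auto
      ultimately have "(V x + ?e) powr q \<le> 3 powr q * (V x powr q + 1)" by linarith
      then have "(V x + ?e) powr q * \<rho> x \<le> 3 powr q * (V x powr q + 1) * \<rho> x"
        using \<rho> by (rule mult_right_mono)
      also have "\<dots> = 3 powr q * (V x powr q * \<rho> x + \<rho> x)" by (simp add: algebra_simps)
      finally show ?thesis
        using True \<rho> by (simp add: ennreal_leI flip: ennreal_mult ennreal_plus)
    qed simp
  qed
  have "(\<integral>\<^sup>+ x. ?u n x \<partial>M) \<le> (\<integral>\<^sup>+ x. ?w x \<partial>M)" for n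
    using bound by (intro nn_integral_mono_AE)
  then show "(\<integral>\<^sup>+ x. ?u n x \<partial>M) < \<infinity>" using w by (rule le_less_trans)
  show "(\<lambda>n. \<integral>\<^sup>+ x. ?u n x \<partial>M) \<longlonglongrightarrow> (\<integral>\<^sup>+ x\<in>\<Omega>. ennreal (V x powr q * \<rho> x) \<partial>M)"
  proof (rule nn_integral_dominated_convergence[OF _ _ _ bound w])
    show "AE x in M. (\<lambda>n. ?u n x) \<longlonglongrightarrow> ennreal (V x powr q * \<rho> x) * indicator \<Omega> x"
      using pos
    proof eventually_elim
      case (elim x)
      show ?case
      proof (cases "x \<in> \<Omega>")
        case True
        with elim have V: "0 < V x" by simp
        have "(\<lambda>n. V x + inverse (real (Suc n))) \<longlonglongrightarrow> V x + 0"
          by (intro tendsto_add tendsto_const LIMSEQ_inverse_real_of_nat)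
        then have "(\<lambda>n. (V x + inverse (real (Suc n))) powr q * \<rho> x) \<longlonglongrightarrow> V x powr q * \<rho> x"
          using V by (intro tendsto_mult tendsto_powr tendsto_const) auto
        then show ?thesis using True by (simp add: tendsto_ennrealI del: of_nat_Suc)
      qed simp
    qed
  qed measurable
qed

context vector_field_family
begin

text \<open>The exponent \<open>p\<close> is the one for which the mixed term contains
  \<open>\<phi>\<close> and the gradient of \<open>v\<close> to the same power \<open>p - 1\<close>,
  so that Young's inequality returns the weight \<open>\<phi> powr p\<close> of the energy.\<close>

lemma
  assumes \<phi>: "\<phi> \<in> C0k A 1 \<Omega>" and nonneg: "\<And>x. 0 \<le> \<phi> x" and p: "1 < p"
  shows C0k_powr: "(\<lambda>x. \<phi> x powr p) \<in> C0k A 1 \<Omega>"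
    and X_grad_powr: "X_grad A X (\<lambda>x. \<phi> x powr p) x = (p * \<phi> x powr (p - 1)) *\<^sub>R X_grad A X \<phi> x"
proof -
  have C1: "C1 \<phi>" and K: "compact (closure {x. \<phi> x \<noteq> 0})" "closure {x. \<phi> x \<noteq> 0} \<subseteq> \<Omega>"
    using \<phi> C0k_1_iff by blast+
  have eq: "(\<lambda>x. \<phi> x powr p) = (\<lambda>x. \<bar>\<phi> x\<bar> powr p)" using nonneg by simp
  note compose = has_real_derivative_abs_powr[OF p] continuous_on_abs_powr_derivative[OF p]
  have "C1 (\<lambda>x. \<phi> x powr p)"
    unfolding eq by (rule C1_compose[OF C1 compose])
  moreover have "{x. \<phi> x powr p \<noteq> 0} = {x. \<phi> x \<noteq> 0}" by simp
  ultimately show "(\<lambda>x. \<phi> x powr p) \<in> C0k A 1 \<Omega>"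
    using K C0k_1_iff by simp
  have "p * sgn (\<phi> x) * \<bar>\<phi> x\<bar> powr (p - 1) = p * \<phi> x powr (p - 1)"
    using nonneg[of x] by (auto simp: sgn_if)
  then show "X_grad A X (\<lambda>x. \<phi> x powr p) x = (p * \<phi> x powr (p - 1)) *\<^sub>R X_grad A X \<phi> x"
    unfolding eq using X_grad_compose[OF C1 compose, of x] by simp
qed

text \<open>The weak inequality is tested with \<open>\<phi> powr p * H v\<close>. Nothing about the
  truncated power enters except bounds, signs and the Young inequality, hence \<open>H\<close> and
  \<open>W\<close> are abstract. The part of \<open>lam\<close> that has the good sign stays on the
  left, so that both sides are integrals of functions that are nonnegative almost
  everywhere.\<close>

lemma energy_estimate:
  fixes H H' W :: "real \<Rightarrow> real"
  assumes \<Omega>: "open \<Omega>" and p: "1 < p"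
    and sub: "sub_solution A \<mu> X \<Omega> p lam v" and pos: "AE x in \<mu>. x \<in> \<Omega> \<longrightarrow> 0 < v x"
    and g: "has_X_grad A \<mu> X \<Omega> p v g"
    and \<phi>: "\<phi> \<in> C0k A 1 \<Omega>" and nonneg: "\<And>x. 0 \<le> \<phi> x"
    and H: "\<And>t. (H has_real_derivative H' t) (at t)" and H': "continuous_on UNIV H'"
    and B: "\<And>t. \<bar>H t\<bar> \<le> B" "\<And>t. \<bar>H' t\<bar> \<le> B"
    and H_pos: "\<And>t. 0 < H t" "\<And>t. 0 < t \<Longrightarrow> 0 \<le> H' t"
    and [measurable]: "W \<in> borel_measurable borel" and W: "\<And>t. 0 < t \<Longrightarrow> 0 \<le> W t"
    and Young: "\<And>t y z. 0 < t \<Longrightarrow> 0 \<le> y \<Longrightarrow> 0 \<le> z \<Longrightarrow>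
      p * H t * y powr (p - 1) * z \<le> (p - 1) / p * H' t * y powr p + W t * z powr p"
    and fin: "(\<integral>\<^sup>+ x\<in>\<Omega>. ennreal (W (v x) * norm (X_grad A X \<phi> x) powr p) \<partial>\<mu>) < \<infinity>"
  shows "(\<integral>\<^sup>+ x\<in>\<Omega>. ennreal (H' (v x) * \<phi> x powr p * norm (g x) powr p
        + p * max (- lam) 0 * (v x powr (p - 1) * \<phi> x powr p * H (v x))) \<partial>\<mu>)
    \<le> ennreal p * (\<integral>\<^sup>+ x\<in>\<Omega>. ennreal (W (v x) * norm (X_grad A X \<phi> x) powr p) \<partial>\<mu>)
      + ennreal (p * max lam 0) * (\<integral>\<^sup>+ x\<in>\<Omega>. ennreal (v x powr (p - 1) * \<phi> x powr p * H (v x)) \<partial>\<mu>)"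
proof -
  define \<psi> where "\<psi> x = \<phi> x powr p" for x
  have \<psi>: "\<psi> \<in> C0k A 1 \<Omega>" and X\<psi>: "X_grad A X \<psi> x = (p * \<phi> x powr (p - 1)) *\<^sub>R X_grad A X \<phi> x" for x
    unfolding \<psi>_def[abs_def] using C0k_powr[OF \<phi> nonneg p] X_grad_powr[OF \<phi> nonneg p] .
  have \<psi>0: "0 \<le> \<psi> x" for x by (simp add: \<psi>_def)
  have C1: "C1 \<phi>" by (rule C0k_C1[OF \<phi>])
  have off: "\<phi> x = 0" "\<psi> x = 0" "X_grad A X \<phi> x = 0" if "x \<notin> \<Omega>" for x
  proof -
    have "closure {x. \<phi> x \<noteq> 0} \<subseteq> \<Omega>" using \<phi> C0k_1_iff by blast
    then have nc: "x \<notin> closure {x. \<phi> x \<noteq> 0}" using that by (rule contra_subsetD)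
    then show "X_grad A X \<phi> x = 0" by (rule X_grad_support[OF C1])
    have "x \<notin> {x. \<phi> x \<noteq> 0}" by (rule contra_subsetD[OF closure_subset nc])
    then show "\<phi> x = 0" by simp
    then show "\<psi> x = 0" by (simp add: \<psi>_def)
  qed
  have [measurable]: "\<Omega> \<in> sets \<mu>" using \<Omega> by simp
  define G where "G x = indicator \<Omega> x *\<^sub>R g x" for x
  define V where "V x = indicator \<Omega> x * v x" for x
  have [measurable]: "G \<in> borel_measurable \<mu>" "V \<in> borel_measurable \<mu>"
    using has_X_grad_measurable[OF g] unfolding G_def V_def .
  have [measurable]: "\<phi> \<in> borel_measurable \<mu>" "X_grad A X \<phi> \<in> borel_measurable \<mu>"
    using C1_measurable[OF C1] X_grad_measurable[OF C1] .
  have [measurable]: "\<psi> \<in> borel_measurable \<mu>" unfolding \<psi>_def[abs_def] by measurable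
  have "continuous_on UNIV H"
    using H by (meson DERIV_isCont continuous_at_imp_continuous_on)
  then have [measurable]: "H \<in> borel_measurable borel" "H' \<in> borel_measurable borel"
    using H' by (auto intro: borel_measurable_continuous_onI)

  define a where "a x = H' (V x) * \<psi> x * norm (G x) powr p" for x
  define R where "R x = norm (G x) powr (p - 2) * (G x \<bullet> (H (V x) *\<^sub>R X_grad A X \<psi> x))" for x
  define b where "b x = \<bar>V x\<bar> powr (p - 2) * V x * (\<psi> x * H (V x))" for x
  define k where "k x = W (V x) * norm (X_grad A X \<phi> x) powr p" for x
  have [measurable]: "a \<in> borel_measurable \<mu>" "b \<in> borel_measurable \<mu>" "k \<in> borel_measurable \<mu>"
    unfolding a_def[abs_def] b_def[abs_def] k_def[abs_def] by measurable
  have [measurable]: "R \<in> borel_measurable \<mu>"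
    unfolding R_def[abs_def] X\<psi> by measurable

  \<comment> \<open>\<open>R\<close> is the mixed term, estimated by Cauchy-Schwarz and then by the
    Young hypothesis; off \<open>\<Omega>\<close> all four functions vanish.\<close>
  have pointwise: "AE x in \<mu>. 0 \<le> a x \<and> 0 \<le> b x \<and> 0 \<le> k x \<and> \<bar>R x\<bar> \<le> (p - 1) / p * a x + k x
      \<and> (x \<in> \<Omega> \<longrightarrow> b x = v x powr (p - 1) * \<phi> x powr p * H (v x))"
    using pos
  proof eventually_elim
    case (elim x)
    show ?case
    proof (cases "x \<in> \<Omega>")
      case True
      then have V: "0 < V x" "V x = v x" using elim by (auto simp: V_def)
      have "\<bar>V x\<bar> powr (p - 2) * V x = V x powr (p - 1)"
        using V by (simp add: powr_mult_base mult.commute)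
      then have b: "b x = v x powr (p - 1) * \<phi> x powr p * H (v x)"
        using V by (simp add: b_def \<psi>_def)
      have "\<bar>R x\<bar> \<le> norm (G x) powr (p - 2) * (norm (G x) * norm (H (V x) *\<^sub>R X_grad A X \<psi> x))"
        unfolding R_def abs_mult by (intro mult_mono Cauchy_Schwarz_ineq2) auto
      also have "\<dots> = p * H (V x) * (\<phi> x * norm (G x)) powr (p - 1) * norm (X_grad A X \<phi> x)"
      proof -
        have "norm (G x) powr (p - 2) * norm (G x) = norm (G x) powr (p - 1)"
          by (simp add: powr_mult_base mult.commute)
        then show ?thesis
          using p H_pos(1)[of "V x"] nonneg[of x] by (simp add: X\<psi> powr_mult mult_ac)
      qed
      also have "\<dots> \<le> (p - 1) / p * H' (V x) * (\<phi> x * norm (G x)) powr p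
          + W (V x) * norm (X_grad A X \<phi> x) powr p"
        using V nonneg by (intro Young) auto
      also have "\<dots> = (p - 1) / p * a x + k x"
        using nonneg[of x] by (simp add: a_def k_def \<psi>_def powr_mult)
      finally show ?thesis
        using b V H_pos(1)[of "v x"] H_pos(2)[of "v x"] W[of "v x"] \<psi>0[of x]
        by (simp add: a_def k_def)
    next
      case False
      then show ?thesis using off[OF False] by (simp add: a_def b_def k_def R_def G_def)
    qed
  qed
  have a0: "AE x in \<mu>. 0 \<le> a x" and b0: "AE x in \<mu>. 0 \<le> b x" and k0: "AE x in \<mu>. 0 \<le> k x"
    and R_le: "AE x in \<mu>. \<bar>R x\<bar> \<le> (p - 1) / p * a x + k x"
    using pointwise by auto

  have k_nn: "(\<integral>\<^sup>+ x. ennreal (k x) \<partial>\<mu>)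
      = (\<integral>\<^sup>+ x\<in>\<Omega>. ennreal (W (v x) * norm (X_grad A X \<phi> x) powr p) \<partial>\<mu>)"
    by (intro nn_integral_cong) (auto simp: k_def V_def off indicator_def)
  have k_int: "integrable \<mu> k"
    using k_nn fin k0 by (intro integrableI_nonneg) auto
  \<comment> \<open>Absorbing part of this integral is legitimate only if it is finite. This follows
    from the bound on \<open>H'\<close> and from the \<open>L^p\<close> gradient of
    \<open>v\<close>.\<close>
  have a_int: "integrable \<mu> a"
  proof -
    obtain P where P: "P \<ge> 0" "\<And>x. \<bar>\<psi> x\<bar> \<le> P" using C0k_bounded[OF \<psi>] by blast
    have "(\<integral>\<^sup>+ x. ennreal (norm (G x) powr p) \<partial>\<mu>) = (\<integral>\<^sup>+ x\<in>\<Omega>. ennreal (norm (g x) powr p) \<partial>\<mu>)"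
      by (intro nn_integral_cong) (auto simp: G_def indicator_def)
    then have "integrable \<mu> (\<lambda>x. norm (G x) powr p)"
      using has_X_grad_Lp[OF g \<Omega>] p by (intro integrableI_nonneg) auto
    then have "integrable \<mu> (\<lambda>x. B * P * norm (G x) powr p)" by simp
    then show ?thesis
    proof (rule Bochner_Integration.integrable_bound)
      have "norm (a x) \<le> norm (B * P * norm (G x) powr p)" for x
        using P B(2)[of "V x"] unfolding a_def
        by (auto simp: abs_mult intro!: mult_mono)
      then show "AE x in \<mu>. norm (a x) \<le> norm (B * P * norm (G x) powr p)" by simp
    qed measurable
  qed
  have R_int: "integrable \<mu> R"
  proof (rule Bochner_Integration.integrable_bound)
    show "integrable \<mu> (\<lambda>x. (p - 1) / p * a x + k x)" using a_int k_int by simp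
    show "AE x in \<mu>. norm (R x) \<le> norm ((p - 1) / p * a x + k x)"
      using R_le by eventually_elim simp
  qed measurable

  have test: "has_X_grad A \<mu> X \<Omega> p (\<lambda>x. \<psi> x * H (v x))
      (\<lambda>x. H (v x) *\<^sub>R X_grad A X \<psi> x + (\<psi> x * H' (v x)) *\<^sub>R g x)"
    by (rule has_X_grad_mult_compose[OF g \<Omega> _ \<psi> H H' B]) (use p in simp)
  have "AE x in \<mu>. x \<in> \<Omega> \<longrightarrow> 0 \<le> \<psi> x * H (v x)"
    using \<psi>0 less_imp_le[OF H_pos(1)] by (auto intro!: AE_I2 mult_nonneg_nonneg)
  with sub g test have weak:
    "set_integrable \<mu> \<Omega> (\<lambda>x. lam * (\<bar>v x\<bar> powr (p - 2) * v x * (\<psi> x * H (v x))))"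
    "(LINT x:\<Omega>|\<mu>. norm (g x) powr (p - 2) *
        (g x \<bullet> (H (v x) *\<^sub>R X_grad A X \<psi> x + (\<psi> x * H' (v x)) *\<^sub>R g x)))
      - lam * (LINT x:\<Omega>|\<mu>. \<bar>v x\<bar> powr (p - 2) * v x * (\<psi> x * H (v x))) \<le> 0"
    unfolding sub_solution_def by blast+
  have eq_b: "indicator \<Omega> x *\<^sub>R (\<bar>v x\<bar> powr (p - 2) * v x * (\<psi> x * H (v x))) = b x" for x
    by (cases "x \<in> \<Omega>") (auto simp: b_def V_def off)
  have eq_F: "indicator \<Omega> x *\<^sub>R (norm (g x) powr (p - 2) *
      (g x \<bullet> (H (v x) *\<^sub>R X_grad A X \<psi> x + (\<psi> x * H' (v x)) *\<^sub>R g x))) = R x + a x" for x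
  proof (cases "x \<in> \<Omega>")
    case True
    have "norm (g x) powr (p - 2) * (g x \<bullet> g x) = norm (g x) powr p"
    proof (cases "g x = 0")
      case False
      have "norm (g x) powr (p - 2) * norm (g x) powr 2 = norm (g x) powr p"
        unfolding powr_add[symmetric] by simp
      then show ?thesis using False by (simp add: dot_square_norm)
    qed (use p in simp)
    then have "norm (g x) powr (p - 2) * (g x \<bullet> ((\<psi> x * H' (v x)) *\<^sub>R g x)) = a x"
      using True by (simp add: a_def V_def G_def mult_ac)
    then show ?thesis using True by (simp add: R_def V_def G_def inner_add_right distrib_left)
  qed (simp add: R_def a_def G_def off)
  \<comment> \<open>For \<open>lam = 0\<close> nothing is known about \<open>b\<close> alone, so the
    factor is kept inside the integral.\<close>
  have lam_b_int: "integrable \<mu> (\<lambda>x. lam * b x)"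
    using weak(1) unfolding set_integrable_def eq_b[symmetric] by (simp add: mult_ac)
  have "(\<integral>x. R x + a x \<partial>\<mu>) - lam * (\<integral>x. b x \<partial>\<mu>) \<le> 0"
    using weak(2) unfolding set_lebesgue_integral_def eq_b eq_F .
  then have weak': "(\<integral>x. R x \<partial>\<mu>) + (\<integral>x. a x \<partial>\<mu>) \<le> (\<integral>x. lam * b x \<partial>\<mu>)"
    using R_int a_int by simp
  have "- (\<integral>x. R x \<partial>\<mu>) = (\<integral>x. - R x \<partial>\<mu>)" by simp
  also have "\<dots> \<le> (\<integral>x. (p - 1) / p * a x + k x \<partial>\<mu>)"
    using R_le a_int k_int R_int by (intro integral_mono_AE) auto
  also have "\<dots> = (p - 1) / p * (\<integral>x. a x \<partial>\<mu>) + (\<integral>x. k x \<partial>\<mu>)"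
    using a_int k_int by simp
  \<comment> \<open>After absorption the fraction \<open>1 - (p - 1) / p = 1 / p\<close> of the
    energy is left, which puts the factor \<open>p\<close> on the right side of
    \<open>main\<close>.\<close>
  finally have "(\<integral>x. a x \<partial>\<mu>) - (p - 1) / p * (\<integral>x. a x \<partial>\<mu>) \<le> (\<integral>x. lam * b x \<partial>\<mu>) + (\<integral>x. k x \<partial>\<mu>)"
    using weak' by linarith
  also have "(\<integral>x. a x \<partial>\<mu>) - (p - 1) / p * (\<integral>x. a x \<partial>\<mu>) = (\<integral>x. a x \<partial>\<mu>) / p"
    using p by (simp add: field_simps)
  finally have main: "(\<integral>x. a x \<partial>\<mu>) \<le> p * (\<integral>x. lam * b x \<partial>\<mu>) + p * (\<integral>x. k x \<partial>\<mu>)"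
    using p by (simp add: field_simps)

  have int_pm: "integrable \<mu> (\<lambda>x. p * max (- lam) 0 * b x)" "integrable \<mu> (\<lambda>x. p * max lam 0 * b x)"
  proof -
    have "integrable \<mu> b" if "lam \<noteq> 0" using lam_b_int that by simp
    then show "integrable \<mu> (\<lambda>x. p * max (- lam) 0 * b x)" "integrable \<mu> (\<lambda>x. p * max lam 0 * b x)"
      by (cases "lam = 0"; simp)+
  qed
  \<comment> \<open>With \<open>lam\<close> written as the difference of its positive and negative
    parts, the negative part can change sides and every summand becomes nonnegative almost
    everywhere.\<close>
  have "p * (\<integral>x. lam * b x \<partial>\<mu>) = (\<integral>x. p * max lam 0 * b x - p * max (- lam) 0 * b x \<partial>\<mu>)"
    unfolding integral_mult_right_zero[symmetric]
    by (intro Bochner_Integration.integral_cong) (auto simp: max_def)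
  then have le: "(\<integral>x. a x + p * max (- lam) 0 * b x \<partial>\<mu>)
      \<le> (\<integral>x. p * k x + p * max lam 0 * b x \<partial>\<mu>)"
    using main a_int k_int int_pm by simp
  have nn_lhs: "(\<integral>\<^sup>+ x. ennreal (a x + p * max (- lam) 0 * b x) \<partial>\<mu>)
      = ennreal (\<integral>x. a x + p * max (- lam) 0 * b x \<partial>\<mu>)"
  proof (rule nn_integral_eq_integral)
    show "AE x in \<mu>. 0 \<le> a x + p * max (- lam) 0 * b x"
      using a0 b0
    proof eventually_elim
      case (elim x)
      then show ?case using p by simp
    qed
  qed (use a_int int_pm in simp)
  have nn_rhs: "(\<integral>\<^sup>+ x. ennreal (p * k x + p * max lam 0 * b x) \<partial>\<mu>)
      = ennreal (\<integral>x. p * k x + p * max lam 0 * b x \<partial>\<mu>)"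
  proof (rule nn_integral_eq_integral)
    show "AE x in \<mu>. 0 \<le> p * k x + p * max lam 0 * b x"
      using k0 b0
    proof eventually_elim
      case (elim x)
      then show ?case using p by simp
    qed
  qed (use k_int int_pm in simp)
  from le have "(\<integral>\<^sup>+ x. ennreal (a x + p * max (- lam) 0 * b x) \<partial>\<mu>)
      \<le> (\<integral>\<^sup>+ x. ennreal (p * k x + p * max lam 0 * b x) \<partial>\<mu>)"
    unfolding nn_lhs nn_rhs by (rule ennreal_leI)
  also have "(\<integral>\<^sup>+ x. ennreal (p * k x + p * max lam 0 * b x) \<partial>\<mu>)
      = (\<integral>\<^sup>+ x. ennreal p * ennreal (k x) + ennreal (p * max lam 0) * ennreal (b x) \<partial>\<mu>)"
  proof (rule nn_integral_cong_AE)
    show "AE x in \<mu>. ennreal (p * k x + p * max lam 0 * b x)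
        = ennreal p * ennreal (k x) + ennreal (p * max lam 0) * ennreal (b x)"
      using k0 b0
    proof eventually_elim
      case (elim x)
      have "0 \<le> p * k x" "0 \<le> p * max lam 0" "0 \<le> p * max lam 0 * b x" "0 \<le> p"
        using elim p by simp_all
      with elim show ?case by (simp only: ennreal_plus ennreal_mult)
    qed
  qed
  also have "\<dots> = ennreal p * (\<integral>\<^sup>+ x. ennreal (k x) \<partial>\<mu>)
      + ennreal (p * max lam 0) * (\<integral>\<^sup>+ x. ennreal (b x) \<partial>\<mu>)"
    by (simp add: nn_integral_add nn_integral_cmult)
  also have "(\<integral>\<^sup>+ x. ennreal (b x) \<partial>\<mu>)
      = (\<integral>\<^sup>+ x\<in>\<Omega>. ennreal (v x powr (p - 1) * \<phi> x powr p * H (v x)) \<partial>\<mu>)"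
  proof (rule nn_integral_cong_AE)
    show "AE x in \<mu>. ennreal (b x)
        = ennreal (v x powr (p - 1) * \<phi> x powr p * H (v x)) * indicator \<Omega> x"
      using pointwise
    proof eventually_elim
      case (elim x)
      then show ?case by (cases "x \<in> \<Omega>") (simp_all add: b_def off)
    qed
  qed
  also have "(\<integral>\<^sup>+ x. ennreal (a x + p * max (- lam) 0 * b x) \<partial>\<mu>)
      = (\<integral>\<^sup>+ x\<in>\<Omega>. ennreal (H' (v x) * \<phi> x powr p * norm (g x) powr p
        + p * max (- lam) 0 * (v x powr (p - 1) * \<phi> x powr p * H (v x))) \<partial>\<mu>)"
  proof (rule nn_integral_cong_AE)
    show "AE x in \<mu>. ennreal (a x + p * max (- lam) 0 * b x)
        = ennreal (H' (v x) * \<phi> x powr p * norm (g x) powr p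
          + p * max (- lam) 0 * (v x powr (p - 1) * \<phi> x powr p * H (v x))) * indicator \<Omega> x"
      using pointwise
    proof eventually_elim
      case (elim x)
      show ?case
      proof (cases "x \<in> \<Omega>")
        case True
        then have "a x = H' (v x) * \<phi> x powr p * norm (g x) powr p"
          by (simp add: a_def V_def G_def \<psi>_def)
        with elim True show ?thesis by simp
      qed (simp add: a_def b_def off)
    qed
  qed
  finally show ?thesis unfolding k_nn .
qed

lemma C0k_Lp:
  assumes "u \<in> C0k A 1 \<Omega>" "0 < p"
  shows "(\<integral>\<^sup>+ x. ennreal (\<bar>u x\<bar> powr p) \<partial>\<mu>) < \<infinity>"
proof -
  let ?K = "closure {x. u x \<noteq> 0}"
  have K: "compact ?K" using assms(1) C0k_1_iff by blast
  obtain B where B: "B \<ge> 0" "\<And>x. \<bar>u x\<bar> \<le> B" using C0k_bounded[OF assms(1)] by blast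
  have "(\<integral>\<^sup>+ x. ennreal (\<bar>u x\<bar> powr p) \<partial>\<mu>) \<le> (\<integral>\<^sup>+ x. ennreal (B powr p) * indicator ?K x \<partial>\<mu>)"
  proof (rule nn_integral_mono)
    fix x
    show "ennreal (\<bar>u x\<bar> powr p) \<le> ennreal (B powr p) * indicator ?K x"
    proof (cases "u x = 0")
      case False
      then have "x \<in> ?K" using subsetD[OF closure_subset, of x "{x. u x \<noteq> 0}"] by simp
      then show ?thesis using B assms(2) by (simp add: ennreal_leI powr_mono2)
    qed (use assms(2) in simp)
  qed
  also have "\<dots> = ennreal (B powr p) * emeasure \<mu> ?K"
    by (intro nn_integral_cmult_indicator) (simp add: borel_closed)
  also have "\<dots> < \<infinity>"
    using compact_finite_measure[OF K] by (simp add: ennreal_mult_less_top)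
  finally show ?thesis .
qed

text \<open>The two finiteness assumptions provide the majorants on the right. For negative
  \<open>lam\<close> the integral \<open>L\<close> stands on the left, where Fatou's lemma allows it
  to be infinite.\<close>

lemma caccioppoli_ennreal:
  assumes \<Omega>: "open \<Omega>" and p: "1 < p" and s: "0 < s"
    and sub: "sub_solution A \<mu> X \<Omega> p lam v" and pos: "AE x in \<mu>. x \<in> \<Omega> \<longrightarrow> 0 < v x"
    and g: "has_X_grad A \<mu> X \<Omega> p v g"
    and \<phi>: "\<phi> \<in> C0k A 1 \<Omega>" and nonneg: "\<And>x. 0 \<le> \<phi> x"
  defines "I \<equiv> \<integral>\<^sup>+ x\<in>\<Omega>. ennreal (v x powr (s - 1) * \<phi> x powr p * norm (g x) powr p) \<partial>\<mu>"
    and "K \<equiv> \<integral>\<^sup>+ x\<in>\<Omega>. ennreal (v x powr (s + p - 1) * norm (X_grad A X \<phi> x) powr p) \<partial>\<mu>"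
    and "L \<equiv> \<integral>\<^sup>+ x\<in>\<Omega>. ennreal (v x powr (s + p - 1) * \<phi> x powr p) \<partial>\<mu>"
  assumes K: "K < \<infinity>" and L: "0 < lam \<Longrightarrow> L < \<infinity>"
  shows "ennreal s * I + ennreal (p * max (- lam) 0) * L
    \<le> ennreal p * (ennreal ((p / s) powr (p - 1)) * K) + ennreal (p * max lam 0) * L"
proof -
  define C where "C = (p / s) powr (p - 1)"
  define q where "q = s + p - 1"
  have q: "0 < q" using s p by (simp add: q_def)
  define e where "e n = inverse (real (Suc n))" for n
  have e: "0 < e n" "0 \<le> e n" for n by (simp_all add: e_def)
  have e_lim: "e \<longlonglongrightarrow> 0" unfolding e_def by (rule LIMSEQ_inverse_real_of_nat)
  have [measurable]: "\<Omega> \<in> sets \<mu>" using \<Omega> by simp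
  define G where "G x = indicator \<Omega> x *\<^sub>R g x" for x
  define V where "V x = indicator \<Omega> x * v x" for x
  have [measurable]: "G \<in> borel_measurable \<mu>" "V \<in> borel_measurable \<mu>"
    using has_X_grad_measurable[OF g] unfolding G_def V_def .
  have [measurable]: "\<phi> \<in> borel_measurable \<mu>" "X_grad A X \<phi> \<in> borel_measurable \<mu>"
    using C1_measurable X_grad_measurable C0k_C1[OF \<phi>] by blast+
  have V_eq: "V x = v x" and G_eq: "G x = g x" if "x \<in> \<Omega>" for x
    using that by (simp_all add: V_def G_def)
  have V_pos: "AE x in \<mu>. x \<in> \<Omega> \<longrightarrow> 0 < V x"
    using pos by eventually_elim (simp add: V_def)
  have cong: "(\<integral>\<^sup>+ x\<in>\<Omega>. F x \<partial>\<mu>) = (\<integral>\<^sup>+ x\<in>\<Omega>. F' x \<partial>\<mu>)" if "\<And>x. x \<in> \<Omega> \<Longrightarrow> F x = F' x"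
    for F F' :: "'m \<Rightarrow> ennreal"
    using that by (intro nn_integral_cong) (auto simp: indicator_def)
  have on_\<Omega>: "(\<integral>\<^sup>+ x\<in>\<Omega>. F x \<partial>\<mu>) \<le> (\<integral>\<^sup>+ x. F x \<partial>\<mu>)" for F :: "'m \<Rightarrow> ennreal"
    by (intro nn_integral_mono) (auto simp: indicator_def)

  define k where "k n = (\<integral>\<^sup>+ x\<in>\<Omega>. ennreal ((V x + e n) powr q * norm (X_grad A X \<phi> x) powr p) \<partial>\<mu>)" for n
  define l where "l n = (\<integral>\<^sup>+ x\<in>\<Omega>. ennreal ((V x + e n) powr q * \<phi> x powr p) \<partial>\<mu>)" for n
  have K_V: "K = (\<integral>\<^sup>+ x\<in>\<Omega>. ennreal (V x powr q * norm (X_grad A X \<phi> x) powr p) \<partial>\<mu>)"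
    and L_V: "L = (\<integral>\<^sup>+ x\<in>\<Omega>. ennreal (V x powr q * \<phi> x powr p) \<partial>\<mu>)"
    unfolding K_def L_def q_def by (intro cong; simp add: V_eq)+
  have \<Omega>_sets: "\<Omega> \<in> sets \<mu>" by measurable
  have grad_fin: "(\<integral>\<^sup>+ x\<in>\<Omega>. ennreal (norm (X_grad A X \<phi> x) powr p) \<partial>\<mu>) < \<infinity>"
    using p by (intro le_less_trans[OF on_\<Omega> C0k_grad_Lp[OF \<phi>]]) simp
  have \<phi>_fin: "(\<integral>\<^sup>+ x\<in>\<Omega>. ennreal (\<phi> x powr p) \<partial>\<mu>) < \<infinity>"
    using le_less_trans[OF on_\<Omega> C0k_Lp[OF \<phi>, of p]] nonneg p by simp
  have k_fin: "k n < \<infinity>" for n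
    unfolding k_def e_def
    by (rule shifted_powr_finite[OF _ _ \<Omega>_sets V_pos _ q grad_fin K[unfolded K_V]]) auto
  have k_lim: "k \<longlonglongrightarrow> K"
    unfolding k_def e_def K_V
    by (rule shifted_powr_tendsto[OF _ _ \<Omega>_sets V_pos _ q grad_fin K[unfolded K_V]]) auto
  have l_lim: "l \<longlonglongrightarrow> L" if "0 < lam"
    unfolding l_def e_def L_V
    by (rule shifted_powr_tendsto[OF _ _ \<Omega>_sets V_pos _ q \<phi>_fin L[OF that, unfolded L_V]]) auto

  define a where "a n x = trunc' p s (e n) (V x + e n) * \<phi> x powr p * norm (G x) powr p" for n x
  define b where "b n x = V x powr (p - 1) * \<phi> x powr p * trunc p s (e n) (V x + e n)" for n x
  have [measurable]: "trunc p s c \<in> borel_measurable borel" "trunc' p s c \<in> borel_measurable borel" for c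
    unfolding trunc_def[abs_def] trunc'_def[abs_def] by measurable
  have [measurable]: "a n \<in> borel_measurable \<mu>" "b n \<in> borel_measurable \<mu>" for n
    unfolding a_def[abs_def] b_def[abs_def] by measurable
  define lp where "lp = p * max lam 0"
  define lm where "lm = p * max (- lam) 0"
  have lpm: "0 \<le> lp" "0 \<le> lm" using p by (simp_all add: lp_def lm_def)

  have step: "(\<integral>\<^sup>+ x\<in>\<Omega>. ennreal (a n x + lm * b n x) \<partial>\<mu>) \<le> ennreal p * (ennreal C * k n) + ennreal lp * l n" for n
  proof -
    \<comment> \<open>The shift \<open>e n\<close> is needed because for \<open>s < 1\<close> the
      derivative of the power is unbounded near 0 and \<open>v\<close> is only known to be positive.
      The same number is the truncation parameter.\<close>
    obtain H H' B where H: "\<And>t. (H has_real_derivative H' t) (at t)" "continuous_on UNIV H'"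
      "\<And>t. 0 < H t" "\<And>t. \<bar>H t\<bar> \<le> B" "\<And>t. \<bar>H' t\<bar> \<le> B"
      "\<And>t. 0 \<le> t \<Longrightarrow> H t = trunc p s (e n) (t + e n)" "\<And>t. 0 \<le> t \<Longrightarrow> H' t = trunc' p s (e n) (t + e n)"
      using trunc_test_function[OF p s e(1) e(1)] by metis
    define W where "W t = C * (t + e n) powr q" for t
    have C: "0 \<le> C" by (simp add: C_def)
    have W_nn: "(\<integral>\<^sup>+ x\<in>\<Omega>. ennreal (W (v x) * norm (X_grad A X \<phi> x) powr p) \<partial>\<mu>) = ennreal C * k n"
    proof -
      have "(\<integral>\<^sup>+ x\<in>\<Omega>. ennreal (W (v x) * norm (X_grad A X \<phi> x) powr p) \<partial>\<mu>)
        = (\<integral>\<^sup>+ x\<in>\<Omega>. ennreal C * ennreal ((V x + e n) powr q * norm (X_grad A X \<phi> x) powr p) \<partial>\<mu>)"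
        using C by (intro cong) (simp add: W_def V_eq mult.assoc flip: ennreal_mult)
      also have "\<dots> = ennreal C * k n"
        unfolding k_def by (simp add: nn_integral_cmult mult.assoc)
      finally show ?thesis .
    qed
    have energy: "(\<integral>\<^sup>+ x\<in>\<Omega>. ennreal (H' (v x) * \<phi> x powr p * norm (g x) powr p
        + p * max (- lam) 0 * (v x powr (p - 1) * \<phi> x powr p * H (v x))) \<partial>\<mu>)
      \<le> ennreal p * (\<integral>\<^sup>+ x\<in>\<Omega>. ennreal (W (v x) * norm (X_grad A X \<phi> x) powr p) \<partial>\<mu>)
      + ennreal (p * max lam 0) * (\<integral>\<^sup>+ x\<in>\<Omega>. ennreal (v x powr (p - 1) * \<phi> x powr p * H (v x)) \<partial>\<mu>)"
    proof (rule energy_estimate[OF \<Omega> p sub pos g \<phi> nonneg H(1,2,4,5,3)])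
      show "0 \<le> H' t" if "0 < t" for t
        using trunc'_pos[of "t + e n" "e n" s p] that e s H(7)[of t] by simp
      show "W \<in> borel_measurable borel" unfolding W_def[abs_def] by measurable
      show "0 \<le> W t" for t using C by (simp add: W_def)
      show "p * H t * y powr (p - 1) * z \<le> (p - 1) / p * H' t * y powr p + W t * z powr p"
        if "0 < t" "0 \<le> y" "0 \<le> z" for t y z
        using trunc_Young[OF p _ e(2) s that(2,3), of "t + e n" n] that e(1)[of n] H(6,7)[of t]
        by (simp add: W_def C_def q_def)
      show "(\<integral>\<^sup>+ x\<in>\<Omega>. ennreal (W (v x) * norm (X_grad A X \<phi> x) powr p) \<partial>\<mu>) < \<infinity>"
        unfolding W_nn using k_fin[of n] by (simp add: ennreal_mult_less_top)
    qed
    have "(\<integral>\<^sup>+ x\<in>\<Omega>. ennreal (H' (v x) * \<phi> x powr p * norm (g x) powr p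
        + p * max (- lam) 0 * (v x powr (p - 1) * \<phi> x powr p * H (v x))) \<partial>\<mu>)
      = (\<integral>\<^sup>+ x\<in>\<Omega>. ennreal (a n x + lm * b n x) \<partial>\<mu>)"
    proof (rule nn_integral_cong_AE)
      show "AE x in \<mu>. ennreal (H' (v x) * \<phi> x powr p * norm (g x) powr p
        + p * max (- lam) 0 * (v x powr (p - 1) * \<phi> x powr p * H (v x))) * indicator \<Omega> x
        = ennreal (a n x + lm * b n x) * indicator \<Omega> x"
        using pos
      proof eventually_elim
        case (elim x)
        then show ?case
          by (cases "x \<in> \<Omega>") (simp_all add: a_def b_def lm_def V_eq G_eq H(6,7))
      qed
    qed
    with energy have "(\<integral>\<^sup>+ x\<in>\<Omega>. ennreal (a n x + lm * b n x) \<partial>\<mu>) \<le> ennreal p * (ennreal C * k n)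
        + ennreal lp * (\<integral>\<^sup>+ x\<in>\<Omega>. ennreal (v x powr (p - 1) * \<phi> x powr p * H (v x)) \<partial>\<mu>)"
      unfolding W_nn lp_def by (simp only:)
    \<comment> \<open>The truncated power lies below \<open>?t powr s\<close>, so the zero-order
      term is bounded by the shifted integral \<open>l n\<close>, whose limit is known for positive
      \<open>lam\<close>.\<close>
    moreover have "(\<integral>\<^sup>+ x\<in>\<Omega>. ennreal (v x powr (p - 1) * \<phi> x powr p * H (v x)) \<partial>\<mu>) \<le> l n"
      unfolding l_def
    proof (rule nn_integral_mono_AE)
      show "AE x in \<mu>. ennreal (v x powr (p - 1) * \<phi> x powr p * H (v x)) * indicator \<Omega> x
        \<le> ennreal ((V x + e n) powr q * \<phi> x powr p) * indicator \<Omega> x"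
        using pos
      proof eventually_elim
        case (elim x)
        show ?case
        proof (cases "x \<in> \<Omega>")
          case True
          then have v: "0 < v x" "V x = v x" using elim V_eq by auto
          let ?t = "v x + e n"
          have t: "0 < ?t" "v x \<le> ?t" using v e[of n] by simp_all
          have "H (v x) \<le> ?t powr s"
            using trunc_le_powr[OF p t(1) e(2)] H(6)[of "v x"] v by simp
          moreover have "v x powr (p - 1) \<le> ?t powr (p - 1)"
            using v t p by (intro powr_mono2) auto
          ultimately have "v x powr (p - 1) * H (v x) \<le> ?t powr (p - 1) * ?t powr s"
            using less_imp_le[OF H(3)] by (intro mult_mono) auto
          also have "\<dots> = ?t powr q" unfolding powr_add[symmetric] by (simp add: q_def algebra_simps)
          finally have "v x powr (p - 1) * H (v x) * \<phi> x powr p \<le> ?t powr q * \<phi> x powr p"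
            by (rule mult_right_mono) simp
          then show ?thesis using True v by (simp add: ennreal_leI mult_ac)
        qed simp
      qed
    qed
    ultimately show ?thesis
      by (elim order_trans) (intro add_left_mono mult_left_mono, auto)
  qed

  have rhs_lim: "(\<lambda>n. ennreal p * (ennreal C * k n) + ennreal lp * l n)
      \<longlonglongrightarrow> ennreal p * (ennreal C * K) + ennreal lp * L"
  proof (rule tendsto_add)
    show "(\<lambda>n. ennreal p * (ennreal C * k n)) \<longlonglongrightarrow> ennreal p * (ennreal C * K)"
      by (intro ennreal_tendsto_cmult k_lim) auto
    show "(\<lambda>n. ennreal lp * l n) \<longlonglongrightarrow> ennreal lp * L"
    proof (cases "0 < lam")
      case True
      then show ?thesis by (intro ennreal_tendsto_cmult l_lim) auto
    next
      case False
      \<comment> \<open>Here \<open>l n\<close> and \<open>L\<close> may be infinite, but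
        \<open>0 * \<infinity> = 0\<close> in \<open>ennreal\<close>.\<close>
      then have "lp = 0" by (simp add: lp_def)
      then show ?thesis by simp
    qed
  qed

  let ?lim = "\<lambda>x. ennreal (s * (V x powr (s - 1) * \<phi> x powr p * norm (G x) powr p)
      + lm * (V x powr q * \<phi> x powr p)) * indicator \<Omega> x"
  have "ennreal s * I + ennreal lm * L = (\<integral>\<^sup>+ x. ?lim x \<partial>\<mu>)"
  proof -
    have I_V: "I = (\<integral>\<^sup>+ x\<in>\<Omega>. ennreal (V x powr (s - 1) * \<phi> x powr p * norm (G x) powr p) \<partial>\<mu>)"
      unfolding I_def by (intro cong) (simp add: V_eq G_eq)
    have "(\<integral>\<^sup>+ x. ?lim x \<partial>\<mu>) = (\<integral>\<^sup>+ x. ennreal s * (ennreal (V x powr (s - 1) * \<phi> x powr p * norm (G x) powr p) * indicator \<Omega> x)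
        + ennreal lm * (ennreal (V x powr q * \<phi> x powr p) * indicator \<Omega> x) \<partial>\<mu>)"
    proof (rule nn_integral_cong)
      fix x
      have "0 \<le> V x powr (s - 1) * \<phi> x powr p * norm (G x) powr p" "0 \<le> V x powr q * \<phi> x powr p"
        by simp_all
      then show "?lim x = ennreal s * (ennreal (V x powr (s - 1) * \<phi> x powr p * norm (G x) powr p) * indicator \<Omega> x)
        + ennreal lm * (ennreal (V x powr q * \<phi> x powr p) * indicator \<Omega> x)"
        using s lpm
        by (simp only: ennreal_plus ennreal_mult mult_nonneg_nonneg less_imp_le distrib_right mult.assoc)
    qed
    then show ?thesis
      unfolding I_V L_V by (simp add: nn_integral_add nn_integral_cmult)
  qed
  also have "\<dots> = (\<integral>\<^sup>+ x. liminf (\<lambda>n. ennreal (a n x + lm * b n x) * indicator \<Omega> x) \<partial>\<mu>)"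
  proof (rule nn_integral_cong_AE)
    show "AE x in \<mu>. ?lim x = liminf (\<lambda>n. ennreal (a n x + lm * b n x) * indicator \<Omega> x)"
      using V_pos
    proof eventually_elim
      case (elim x)
      show ?case
      proof (cases "x \<in> \<Omega>")
        case True
        with elim have V: "0 < V x" by simp
        have "(\<lambda>n. V x + e n) \<longlonglongrightarrow> V x"
          using tendsto_add[OF tendsto_const e_lim] by simp
        note lims = trunc_tendsto[OF p V s this e_lim]
        have "(\<lambda>n. a n x + lm * b n x) \<longlonglongrightarrow>
            s * V x powr (s - 1) * \<phi> x powr p * norm (G x) powr p
            + lm * (V x powr (p - 1) * \<phi> x powr p * V x powr s)"
          unfolding a_def b_def by (intro tendsto_intros lims)
        moreover have "V x powr (p - 1) * \<phi> x powr p * V x powr s = V x powr q * \<phi> x powr p"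
        proof -
          have "V x powr (p - 1) * V x powr s = V x powr q"
            unfolding powr_add[symmetric] by (simp add: q_def algebra_simps)
          then show ?thesis by (metis mult.assoc mult.commute)
        qed
        ultimately have "(\<lambda>n. ennreal (a n x + lm * b n x)) \<longlonglongrightarrow>
            ennreal (s * (V x powr (s - 1) * \<phi> x powr p * norm (G x) powr p)
            + lm * (V x powr q * \<phi> x powr p))"
          by (intro tendsto_ennrealI) (simp only: mult.assoc)
        from lim_imp_Liminf[OF _ this] show ?thesis using True by simp
      qed (simp add: Liminf_const)
    qed
  qed
  \<comment> \<open>No integrable majorant of the gradient term is available, as the finiteness of
    \<open>I\<close> is itself a consequence of the estimate.\<close>
  also have "\<dots> \<le> liminf (\<lambda>n. \<integral>\<^sup>+ x\<in>\<Omega>. ennreal (a n x + lm * b n x) \<partial>\<mu>)"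
    by (rule nn_integral_liminf) measurable
  also have "\<dots> \<le> liminf (\<lambda>n. ennreal p * (ennreal C * k n) + ennreal lp * l n)"
    using step by (intro Liminf_mono always_eventually) simp
  also have "\<dots> = ennreal p * (ennreal C * K) + ennreal lp * L"
    by (rule lim_imp_Liminf[OF _ rhs_lim]) simp
  finally show ?thesis unfolding C_def lp_def lm_def .
qed

end

theorem theorem3p1:
  fixes A :: "('m::{t2_space, second_countable_topology}, 'n::finite) chart set"
    and w :: "('m, 'n) chart \<Rightarrow> real ^ 'n \<Rightarrow> real"
    and dx :: "'m measure"
    and X :: "'k::finite \<Rightarrow> ('m, 'n) chart \<Rightarrow> real ^ 'n \<Rightarrow> real ^ 'n"
    and \<Omega> :: "'m set"
    and p q lam :: real
    and v \<phi> :: "'m \<Rightarrow> real"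
    and grad_v :: "'m \<Rightarrow> real ^ 'k"
  assumes "smooth_atlas A"
    and "volume_form A w"
    and "volume_measure A w dx"
    and "\<And>k. smooth_vector_field A (X k)"
    and "CARD('k) \<le> CARD('n)"
    and "open \<Omega>"
    and "1 < p"
    and "sub_solution A dx X \<Omega> p lam v"
    and "AE x in dx. x \<in> \<Omega> \<longrightarrow> 0 < v x"
    and "has_X_grad A dx X \<Omega> p v grad_v"
    and "p - 1 < q"
    and "\<phi> \<in> C0_infty A \<Omega>"
    and "\<And>x. 0 \<le> \<phi> x"
  shows "ext_integral dx \<Omega> (\<lambda>x. v x powr (q - p) * \<phi> x powr p * norm (grad_v x) powr p)
    \<le> ereal ((p / (q - p + 1)) powr p)
          * ext_integral dx \<Omega> (\<lambda>x. v x powr q * norm (X_grad A X \<phi> x) powr p)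
        + ereal (lam * p / (q - p + 1))
          * ext_integral dx \<Omega> (\<lambda>x. v x powr q * \<phi> x powr p)"
proof -
  interpret vector_field_family A w dx X
    using assms(1-4) by unfold_locales
  define s where "s = q - p + 1"
  have s: "0 < s" and sq: "s - 1 = q - p" "s + p - 1 = q" using assms(11) by (simp_all add: s_def)
  have p: "1 < p" by fact
  have \<phi>: "\<phi> \<in> C0k A 1 \<Omega>" using assms(12) unfolding C0_infty_def by blast
  define I where "I = (\<integral>\<^sup>+ x\<in>\<Omega>. ennreal (v x powr (q - p) * \<phi> x powr p * norm (grad_v x) powr p) \<partial>dx)"
  define K where "K = (\<integral>\<^sup>+ x\<in>\<Omega>. ennreal (v x powr q * norm (X_grad A X \<phi> x) powr p) \<partial>dx)"
  define L where "L = (\<integral>\<^sup>+ x\<in>\<Omega>. ennreal (v x powr q * \<phi> x powr p) \<partial>dx)"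
  define C where "C = (p / s) powr (p - 1)"
  have C: "0 < C" using p s by (simp add: C_def)
  \<comment> \<open>Division of the limit inequality by \<open>s\<close> produces the factor
    \<open>p / s * C\<close>.\<close>
  have C_eq: "p / s * C = (p / s) powr p"
    unfolding C_def using p s by (subst powr_mult_base) auto
  have main: "ennreal s * I + ennreal (p * max (- lam) 0) * L
      \<le> ennreal p * (ennreal C * K) + ennreal (p * max lam 0) * L"
    if "K < \<infinity>" "0 < lam \<Longrightarrow> L < \<infinity>"
    using caccioppoli_ennreal[OF assms(6) p s assms(8-10) \<phi> assms(13)] that
    unfolding sq I_def K_def L_def C_def by simp
  have "enn2ereal I \<le> ereal ((p / s) powr p) * enn2ereal K + ereal (lam * p / s) * enn2ereal L"
  proof (cases "K < \<infinity> \<and> (0 < lam \<longrightarrow> L < \<infinity>)")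
    case False
    then consider "K = \<infinity>" | "K < \<infinity>" "0 < lam" "L = \<infinity>" by (auto simp flip: less_top)
    then show ?thesis
    proof cases
      case 1
      \<comment> \<open>An infinite \<open>K\<close> has a positive factor, and even if the second
        summand is \<open>-\<infinity>\<close> the sum is \<open>\<infinity>\<close> in
        \<open>ereal\<close>.\<close>
      have "0 < (p / s) powr p" using p s by simp
      with 1 show ?thesis by simp
    next
      case 2
      then have "0 < lam * p / s" using p s by simp
      with 2 p s show ?thesis by simp
    qed
  next
    case True
    then have le: "ennreal s * I + ennreal (p * max (- lam) 0) * L
        \<le> ennreal p * (ennreal C * K) + ennreal (p * max lam 0) * L" using main by blast
    obtain k where k: "K = ennreal k" "0 \<le> k" using True by (cases K) auto
    have rhs_fin: "ennreal p * (ennreal C * K) + ennreal (p * max lam 0) * L < \<infinity>"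
    proof (cases "0 < lam")
      case True
      with \<open>K < \<infinity> \<and> _\<close> show ?thesis by (simp add: ennreal_mult_less_top)
    next
      case False
      then have "max lam 0 = 0" by simp
      then show ?thesis using k by (simp add: ennreal_mult_less_top)
    qed
    \<comment> \<open>Every summand on the left is now finite: this bounds \<open>I\<close>, and
      also \<open>L\<close> when \<open>lam\<close> is negative, where its finiteness was not
      assumed. Only then can the negative term return to the right as a real number.\<close>
    with le have lhs_fin: "ennreal s * I + ennreal (p * max (- lam) 0) * L < \<infinity>"
      by (rule le_less_trans)
    then have "I < \<infinity>" using s by (cases "I = 0") (simp_all add: ennreal_mult_less_top)
    then obtain i where i: "I = ennreal i" "0 \<le> i" by (cases I) auto
    show ?thesis
    \<comment> \<open>For \<open>lam = 0\<close> the integral \<open>L\<close> may be infinite and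
      has no real representative; its factor 0 removes it on both sides.\<close>
    proof (cases "lam = 0")
      case True
      have "s * i \<le> p * (C * k)"
        using le True i k s p C by (simp flip: ennreal_mult)
      then have "i \<le> p / s * C * k" using s by (simp add: field_simps)
      then show ?thesis
        unfolding C_eq using True i k by (simp add: enn2ereal_ennreal zero_ereal_def[symmetric])
    next
      case False
      have "L < \<infinity>"
      proof (cases "0 < lam")
        case False
        with \<open>lam \<noteq> 0\<close> have "0 < p * max (- lam) 0"
          using p by (intro mult_pos_pos) simp_all
        then show ?thesis using lhs_fin p \<open>lam \<noteq> 0\<close> by (cases "L = 0") (simp_all add: ennreal_mult_less_top)
      qed (use \<open>K < \<infinity> \<and> _\<close> in simp)
      then obtain l where l: "L = ennreal l" "0 \<le> l" by (cases L) auto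
      have "s * i + p * max (- lam) 0 * l \<le> p * (C * k) + p * max lam 0 * l"
        using le i k l s p C by (simp flip: ennreal_mult ennreal_plus)
      then have "s * i \<le> p * (C * k) + p * (max lam 0 - max (- lam) 0) * l"
        by (simp add: algebra_simps)
      also have "max lam 0 - max (- lam) 0 = lam" by simp
      finally have "i \<le> p / s * C * k + lam * p / s * l" using s by (simp add: field_simps)
      then show ?thesis
        unfolding C_eq using i k l by (simp add: enn2ereal_ennreal)
    qed
  qed
  then show ?thesis
    unfolding ext_integral_def I_def K_def L_def s_def .
qed

end
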